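(* Let $q$ be a power of $2$. In $\mathrm{PG}(3,q^2)$ let $\mathcal H$ be a non-degenerate Hermitian surface and let $\mathcal Q$ be an irreducible quadric such that $\mathcal H$ and $\mathcal Q$ have the same tangent plane at at least one common non-singular point $P$. Then the size $|\mathcal H\cap\mathcal Q|$ is one of the following: \begin{itemize} \item if $\mathcal Q$ is elliptic: $q^3-q^2+1,\ q^3-q^2+q+1,\ q^3-q+1,\ q^3+1,\ q^3+q+1,\ q^3+q^2-q+1,\ q^3+q^2+1$; \item if $\mathcal Q$ is a quadratic cone: $q^3-q^2+q+1,\ q^3-q+1,\ q^3+q+1,\ q^3+q^2-q+1,\ q^3+2q^2-q+1$; \item if $\mathcal Q$ is hyperbolic: $q^2+1,\ q^3-q^2+1,\ q^3-q^2+q+1,\ q^3-q+1,\ q^3+1,\ q^3+q+1,\ q^3+q^2-q+1,\ q^3+q^2+1,\ q^3+2q^2-q+1,\ q^3+2q^2+1,\ q^3+3q^2-q+1,\ 2q^3+q^2+1$. \end{itemize}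
   Context: An irreducible quadric of $\mathrm{PG}(3,q^2)$ is either a non-degenerate quadric (elliptic or hyperbolic) or a quadratic cone, i.e. the quadric projecting an irreducible conic contained in a plane $\pi$ from a vertex $V\notin\pi$. *)

theory Defs
  imports "HOL-Analysis.Analysis" "HOL-Library.Numeral_Type"
begin

definition pg3_points :: "('a::field ^ 4) set set" where
  "pg3_points = {{c *s v | c. c \<noteq> 0} | v. v \<noteq> 0}"

definition pg3_zero_points :: "('a::field ^ 4 \<Rightarrow> 'a) \<Rightarrow> ('a ^ 4) set set" where
  "pg3_zero_points f = {p \<in> pg3_points. \<forall>v\<in>p. f v = 0}"

subsection \<open>Hermitian surfaces in PG(3,q^2); conjugation is x \<mapsto> x^q\<close>

definition hermitian_matrix :: "nat \<Rightarrow> 'a::field ^ 4 ^ 4 \<Rightarrow> bool" where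
  "hermitian_matrix q H \<longleftrightarrow> (\<forall>i j. H $ j $ i = (H $ i $ j) ^ q)"

definition herm_form :: "nat \<Rightarrow> 'a::field ^ 4 ^ 4 \<Rightarrow> 'a ^ 4 \<Rightarrow> 'a" where
  "herm_form q H x = (\<Sum>i\<in>UNIV. \<Sum>j\<in>UNIV. (x $ i) ^ q * H $ i $ j * x $ j)"

definition nondeg_hermitian :: "nat \<Rightarrow> 'a::field ^ 4 ^ 4 \<Rightarrow> bool" where
  "nondeg_hermitian q H \<longleftrightarrow> hermitian_matrix q H \<and> det H \<noteq> 0"

definition herm_tangent_form :: "nat \<Rightarrow> 'a::field ^ 4 ^ 4 \<Rightarrow> 'a ^ 4 \<Rightarrow> 'a ^ 4 \<Rightarrow> 'a" where
  "herm_tangent_form q H P x = (\<Sum>i\<in>UNIV. \<Sum>j\<in>UNIV. (P $ i) ^ q * H $ i $ j * x $ j)"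

definition herm_nonsingular :: "nat \<Rightarrow> 'a::field ^ 4 ^ 4 \<Rightarrow> 'a ^ 4 \<Rightarrow> bool" where
  "herm_nonsingular q H P \<longleftrightarrow> (\<exists>x. herm_tangent_form q H P x \<noteq> 0)"

definition herm_tangent_plane :: "nat \<Rightarrow> 'a::field ^ 4 ^ 4 \<Rightarrow> 'a ^ 4 \<Rightarrow> ('a ^ 4) set" where
  "herm_tangent_plane q H P = {x. herm_tangent_form q H P x = 0}"

subsection \<open>Quadrics (quadratic forms, valid in characteristic 2)\<close>

definition quad_form :: "'a::field ^ 4 ^ 4 \<Rightarrow> 'a ^ 4 \<Rightarrow> 'a" where
  "quad_form A x = (\<Sum>i\<in>UNIV. \<Sum>j\<in>UNIV. A $ i $ j * x $ i * x $ j)"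

definition polar_form :: "('a::field ^ 4 \<Rightarrow> 'a) \<Rightarrow> 'a ^ 4 \<Rightarrow> 'a ^ 4 \<Rightarrow> 'a" where
  "polar_form Q x y = Q (x + y) - Q x - Q y"

definition quad_nonsingular :: "('a::field ^ 4 \<Rightarrow> 'a) \<Rightarrow> 'a ^ 4 \<Rightarrow> bool" where
  "quad_nonsingular Q P \<longleftrightarrow> (\<exists>x. polar_form Q P x \<noteq> 0)"

definition quad_tangent_plane :: "('a::field ^ 4 \<Rightarrow> 'a) \<Rightarrow> 'a ^ 4 \<Rightarrow> ('a ^ 4) set" where
  "quad_tangent_plane Q P = {x. polar_form Q P x = 0}"

definition proj_equiv_form :: "('a::field ^ 4 \<Rightarrow> 'a) \<Rightarrow> ('a ^ 4 \<Rightarrow> 'a) \<Rightarrow> bool" where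
  "proj_equiv_form Q C \<longleftrightarrow>
     (\<exists>M::'a^4^4. \<exists>c. invertible M \<and> c \<noteq> 0 \<and> (\<forall>x. Q (M *v x) = c * C x))"

definition is_hyperbolic_quadric :: "('a::field ^ 4 \<Rightarrow> 'a) \<Rightarrow> bool" where
  "is_hyperbolic_quadric Q \<longleftrightarrow>
     proj_equiv_form Q (\<lambda>x. x$1 * x$2 + x$3 * x$4)"

definition is_elliptic_quadric :: "('a::field ^ 4 \<Rightarrow> 'a) \<Rightarrow> bool" where
  "is_elliptic_quadric Q \<longleftrightarrow>
     (\<exists>d. (\<forall>t. t^2 + t + d \<noteq> 0) \<and>
        proj_equiv_form Q (\<lambda>x. x$1 * x$2 + x$3^2 + x$3 * x$4 + d * x$4^2))"

text \<open>Quadratic cone (char 2): projects the irreducible conic x1 x2 + x3^2 = 0 of the plane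
  x4 = 0 from the vertex (0,0,0,1).\<close>
definition is_quadratic_cone :: "('a::field ^ 4 \<Rightarrow> 'a) \<Rightarrow> bool" where
  "is_quadratic_cone Q \<longleftrightarrow> proj_equiv_form Q (\<lambda>x. x$1 * x$2 + x$3^2)"

end

theory Submission
  imports Defs "HOL-Computational_Algebra.Polynomial"
begin

text \<open>In coordinates \<open>(J, x, y, z)\<close> adapted to the common tangent plane \<open>J = 0\<close> at \<open>P = (0, 0, 0, 1)\<close>,
  the Hermitian surface is \<open>Tr (J\<^sup>q z) + N x + N y = 0\<close> and the quadric is
  \<open>J z = a x\<^sup>2 + b y\<^sup>2 + c x y + d J x + e J y + f J\<^sup>2\<close>, where \<open>Tr u = u + u\<^sup>q\<close> and \<open>N u = u\<^sup>q\<^sup>+\<^sup>1\<close>.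
  Eliminating \<open>z\<close>, the points with \<open>J = 1\<close> become the zeros of a quadratic polynomial in four variables over
  the subfield \<open>K\<close> of order \<open>q\<close>; its polar form depends only on \<open>c\<close> and is degenerate exactly when \<open>N c = 1\<close>.
  The plane \<open>J = 0\<close> contributes \<open>1 + m q\<^sup>2\<close> points, where \<open>m\<close> is the number of \<open>t\<close> with \<open>N t = 1\<close> and
  \<open>a + c t + b t\<^sup>2 = 0\<close>. If \<open>m > 0\<close>, such a \<open>t\<close> makes the polynomial affine in \<open>x\<close> and the zeros can be counted
  directly; if \<open>m = 0\<close>, the second moment of the value distribution of the quadratic form determines
  the count up to the sign of the form.\<close>


text \<open>The type of the quadric acts only through \<open>a\<close>, \<open>b\<close>,
  \<open>c\<close>. In characteristic 2 squares drop out of the polar form, so a cone forces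
  \<open>c = 0\<close>, a hyperbolic quadric forces \<open>c \<noteq> 0\<close>, and an elliptic
  one, containing no line, forces \<open>a x\<^sup>2 + b y\<^sup>2 + c x y\<close> to be
  anisotropic. The main obstacle is that the affine count and \<open>m\<close> are not independent:
  combining all their possible values would give sizes outside the lists, for example
  \<open>2 q\<^sup>3 + 1\<close>. Hence a common line is used for both counts at once. For
  \<open>N c = 1\<close> the single quantity \<open>Tr (b t c\<^sup>q)\<close> decides both whether
  \<open>m\<close> is 1 or 2 and whether a residual quadratic in one variable over \<open>K\<close>
  loses its leading term; this is the origin of \<open>2 q\<^sup>3 + q\<^sup>2 + 1\<close>. The
  other extreme, \<open>q\<^sup>2 + 1\<close>, arises with \<open>m = 0\<close> when the polynomial
  reduces to an anisotropic form in only two variables over \<open>K\<close>. The second moment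
  suffices because every element of \<open>K\<close> is a square in \<open>K\<close>, so scaling
  identifies the fibres over all non-zero values.\<close>

locale even_square_field =
  fixes q h :: nat and field_type :: "'a::{field,finite} itself"
  assumes q_pow: "q = 2 ^ h" and card_field: "CARD('a) = q ^ 2"
begin

lemma q_ge_2: "q \<ge> 2"
proof -
  \<comment> \<open>A field has at least two elements, which excludes \<open>h = 0\<close>.\<close>
  have "card {0, 1::'a} \<le> CARD('a)" by (rule card_mono) auto
  then have "q \<noteq> 1" using card_field by auto
  then have "h \<noteq> 0" using q_pow by auto
  then show ?thesis using q_pow by (cases h) auto
qed

text \<open>Translation by 1 permutes the field, so adding 1 to every element leaves the sum of all
  elements unchanged; thus the cardinality, a power of 2, vanishes in the field.\<close>

lemma two_eq_0 [simp]: "(2::'a) = 0"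
proof -
  have "(\<Sum>x\<in>(UNIV::'a set). x + 1) = (\<Sum>x\<in>UNIV. x)"
    by (rule sum.reindex_bij_witness[of _ "\<lambda>x. x - 1" "\<lambda>x. x + 1"]) auto
  then have "of_nat CARD('a) = (0::'a)" by (simp add: sum.distrib)
  then show ?thesis using card_field q_pow by simp
qed

lemma add_self [simp]: "(x::'a) + x = 0"
  using two_eq_0 by (metis mult_2 mult_zero_left)

lemma add_self_left [simp]: "(x::'a) + (x + y) = y"
  by (simp add: add.assoc[symmetric])

lemma minus_eq [simp]: "- (x::'a) = x"
  using add_self minus_unique by blast

lemma diff_eq [simp]: "(x::'a) - y = x + y"
  by (metis diff_conv_add_uminus minus_eq)

lemma add_eq_0_iff_eq: "(x::'a) + y = 0 \<longleftrightarrow> x = y"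
  by (metis add_self add_right_cancel)

lemmas char2 = algebra_simps power2_eq_square

section \<open>Conjugation, trace, norm and the fixed field \<open>K\<close>\<close>

definition cj :: "'a \<Rightarrow> 'a" where "cj x = x ^ q"

lemma sq_add: "((x::'a) + y)\<^sup>2 = x\<^sup>2 + y\<^sup>2"
  by (simp add: char2)

lemma cj_add [simp]: "cj (x + y) = cj x + cj y"
proof -
  have "(x + y) ^ 2 ^ n = x ^ 2 ^ n + y ^ 2 ^ n" for n
  proof (induction n)
    case (Suc n)
    then show ?case by (simp add: power_mult mult.commute[of 2] sq_add)
  qed simp
  from this[of h] show ?thesis by (simp add: cj_def flip: q_pow)
qed

lemma cj_mult [simp]: "cj (x * y) = cj x * cj y"
  by (simp add: cj_def power_mult_distrib)

lemma cj_0 [simp]: "cj 0 = 0" and cj_1 [simp]: "cj 1 = 1"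
  using q_ge_2 by (simp_all add: cj_def)

lemma cj_power [simp]: "cj (x ^ n) = cj x ^ n"
  by (simp add: cj_def mult.commute flip: power_mult)

lemma cj_eq_0_iff [simp]: "cj x = 0 \<longleftrightarrow> x = 0"
  using q_ge_2 by (simp add: cj_def)

lemma cj_inverse: "cj (inverse x) = inverse (cj x)"
  by (simp add: cj_def power_inverse)

lemma cj_divide [simp]: "cj (x / y) = cj x / cj y"
  by (simp add: cj_def power_divide)

text \<open>Multiplication by a non-zero \<open>x\<close> permutes the non-zero elements; comparing
  products gives \<open>x ^ (q\<^sup>2 - 1) = 1\<close>.\<close>

lemma cj_cj [simp]: "cj (cj x) = x"
proof (cases "x = 0")
  case False
  have bij: "bij_betw ((*) x) (UNIV - {0}) (UNIV - {0})"
    by (rule bij_betwI[where g = "(*) (inverse x)"]) (use False in auto)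
  have "(\<Prod>y\<in>UNIV - {0}. x * y) = (\<Prod>y\<in>UNIV - {0}. y)"
    by (rule prod.reindex_bij_betw[OF bij])
  then have "x ^ (CARD('a) - 1) = 1"
    by (simp add: prod.distrib prod_constant card_Diff_subset)
  then have "x ^ CARD('a) = x"
    by (metis card_gt_0_iff finite UNIV_not_empty mult.right_neutral power_minus_mult mult.commute mult_1)
  then show ?thesis
    by (simp add: cj_def card_field power2_eq_square flip: power_mult)
qed simp

lemma cj_eq_iff [simp]: "cj x = cj y \<longleftrightarrow> x = y"
  by (metis cj_cj)

definition tr :: "'a \<Rightarrow> 'a" where "tr x = x + cj x"
definition nm :: "'a \<Rightarrow> 'a" where "nm x = x * cj x"
definition K :: "'a set" where "K = {x. cj x = x}"

lemma tr_add: "tr (x + y) = tr x + tr y" by (simp add: tr_def)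
lemma tr_0 [simp]: "tr 0 = 0" by (simp add: tr_def)
lemma nm_mult: "nm (x * y) = nm x * nm y" by (simp add: nm_def)
lemma nm_eq_0_iff [simp]: "nm x = 0 \<longleftrightarrow> x = 0" by (simp add: nm_def)
lemma nm_cj [simp]: "nm (cj x) = nm x" by (simp add: nm_def)
lemma nm_divide: "nm (x / y) = nm x / nm y" by (simp add: nm_def)

lemma tr_in_K [simp]: "tr x \<in> K" by (simp add: tr_def K_def)
lemma nm_in_K [simp]: "nm x \<in> K" by (simp add: nm_def K_def)
lemma K_add [simp]: "x \<in> K \<Longrightarrow> y \<in> K \<Longrightarrow> x + y \<in> K" by (simp add: K_def)
lemma K_mult [simp]: "x \<in> K \<Longrightarrow> y \<in> K \<Longrightarrow> x * y \<in> K" by (simp add: K_def)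
lemma K_divide [simp]: "x \<in> K \<Longrightarrow> y \<in> K \<Longrightarrow> x / y \<in> K" by (simp add: K_def)
lemma K_0 [simp]: "0 \<in> K" and K_1 [simp]: "1 \<in> K" by (simp_all add: K_def)

lemma tr_K_mult: "s \<in> K \<Longrightarrow> tr (s * x) = s * tr x"
  by (simp add: tr_def K_def char2)

lemma tr_eq_0_iff: "tr x = 0 \<longleftrightarrow> x \<in> K"
  by (auto simp: tr_def K_def add_eq_0_iff_eq)

lemma card_additive_fibre:
  fixes f :: "'b::ab_group_add \<Rightarrow> 'c::ab_group_add"
  assumes "\<And>x y. f (x + y) = f x + f y" and "f x0 = k"
  shows "card {x. f x = k} = card {x. f x = 0}"
proof (rule bij_betw_same_card[of "\<lambda>x. x - x0"])
  have "f (x - x0) = f x - f x0" for x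
    by (metis add_diff_cancel_right' assms(1) diff_add_cancel)
  then show "bij_betw (\<lambda>x. x - x0) {x. f x = k} {x. f x = 0}"
    by (intro bij_betwI[where g = "\<lambda>x. x + x0"]) (use assms in auto)
qed

lemma card_eq_sum_fibres:
  fixes f :: "'b \<Rightarrow> 'c"
  assumes "finite A" "finite B" "f ` A \<subseteq> B"
  shows "card A = (\<Sum>k\<in>B. card {x\<in>A. f x = k})"
proof -
  have "A = (\<Union>k\<in>B. {x\<in>A. f x = k})" using assms(3) by auto
  then have "card A = card (\<Union>k\<in>B. {x\<in>A. f x = k})" by simp
  also have "\<dots> = (\<Sum>k\<in>B. card {x\<in>A. f x = k})"
    using assms by (intro card_UN_disjoint) auto
  finally show ?thesis .
qed

lemma card_K_le: "card K \<le> q"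
proof -
  define p :: "'a poly" where "p = monom 1 q - monom 1 1"
  have "coeff p q = 1" using q_ge_2 by (simp add: p_def)
  then have "p \<noteq> 0" by auto
  have "degree p \<le> q" unfolding p_def
    by (rule degree_diff_le) (use q_ge_2 in \<open>auto intro: degree_monom_le order.trans\<close>)
  moreover have "K = {x. poly p x = 0}"
    by (auto simp: K_def p_def poly_monom cj_def add_eq_0_iff_eq)
  ultimately show ?thesis
    using card_poly_roots_bound[OF \<open>p \<noteq> 0\<close>] by simp
qed

text \<open>In characteristic 2 the kernel of \<open>tr\<close> is \<open>K\<close>, and its image
  lies in \<open>K\<close>, so \<open>q\<^sup>2\<close> is the size of the image times
  \<open>|K|\<close>. As \<open>|K| \<le> q\<close>, both factors must be \<open>q\<close>.\<close>

lemma card_K: "card K = q" and tr_surj: "k \<in> K \<Longrightarrow> \<exists>x. tr x = k"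
proof -
  have "CARD('a) = (\<Sum>k\<in>range tr. card {x\<in>UNIV. tr x = k})"
    by (rule card_eq_sum_fibres) auto
  also have "\<dots> = (\<Sum>k\<in>range tr. card K)"
  proof (rule sum.cong)
    fix k assume "k \<in> range tr"
    then obtain x0 where "tr x0 = k" by auto
    then have "card {x. tr x = k} = card {x. tr x = 0}"
      by (rule card_additive_fibre[OF tr_add])
    then show "card {x\<in>UNIV. tr x = k} = card K" by (simp add: tr_eq_0_iff)
  qed simp
  finally have eq: "q * q = card (range tr) * card K"
    by (simp add: card_field power2_eq_square)
  have le: "card (range tr) \<le> card K" by (intro card_mono) auto
  have "q * q \<le> card K * card K" using eq le by simp
  then have "q \<le> card K" by (metis mult_less_le_imp_less linorder_not_le mult_strict_mono' zero_le)
  then show ck: "card K = q" using card_K_le by simp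
  then have "card (range tr) = card K" using eq q_ge_2 by simp
  then have "range tr = K" by (intro card_subset_eq) auto
  then show "k \<in> K \<Longrightarrow> \<exists>x. tr x = k" by (metis rangeE)
qed

lemma card_tr_fibre:
  assumes "k \<in> K"
  shows "card {x. tr x = k} = q"
proof -
  obtain x0 where "tr x0 = k" using tr_surj assms by blast
  then have "card {x. tr x = k} = card {x. tr x = 0}"
    by (rule card_additive_fibre[OF tr_add])
  then show ?thesis by (simp add: tr_eq_0_iff card_K)
qed

lemma card_tr_mult_fibre:
  assumes "k \<in> K" "a \<noteq> 0"
  shows "card {x. tr (a * x) = k} = q"
proof -
  have "bij_betw ((*) a) {x. tr (a * x) = k} {x. tr x = k}"
    by (rule bij_betwI[where g = "\<lambda>x. x / a"]) (use assms in auto)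
  then show ?thesis using card_tr_fibre[OF assms(1)] bij_betw_same_card by fastforce
qed

text \<open>Squaring is additive with trivial kernel, hence injective, hence onto by
  finiteness.\<close>

lemma sqrt_ex: "\<exists>s::'a. s\<^sup>2 = x"
proof -
  have "inj (\<lambda>s::'a. s\<^sup>2)"
  proof (rule injI)
    fix s t :: 'a assume "s\<^sup>2 = t\<^sup>2"
    then have "(s + t)\<^sup>2 = 0" by (simp add: sq_add)
    then show "s = t" by (simp add: add_eq_0_iff_eq)
  qed
  then have "surj (\<lambda>s::'a. s\<^sup>2)" by (simp add: finite_UNIV_inj_surj)
  then show ?thesis by (metis surjE)
qed

lemma sq_eq_iff: "(s::'a)\<^sup>2 = t\<^sup>2 \<longleftrightarrow> s = t"
  by (metis add_eq_0_iff_eq sq_add zero_eq_power2)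

lemma sqrt_K: assumes "k \<in> K" obtains s where "s \<in> K" "s\<^sup>2 = k"
proof -
  obtain s where s: "s\<^sup>2 = k" using sqrt_ex by blast
  then have "(cj s)\<^sup>2 = s\<^sup>2" using assms by (simp add: K_def flip: cj_power)
  then have "s \<in> K" by (simp add: sq_eq_iff K_def)
  then show ?thesis using that s by blast
qed

lemma card_quadratic_le:
  fixes a b c :: 'a
  assumes "a \<noteq> 0 \<or> b \<noteq> 0"
  shows "card {x. a * x\<^sup>2 + b * x + c = 0} \<le> 2"
proof -
  have "card {x. poly [:c, b, a:] x = 0} \<le> degree [:c, b, a:]"
    by (rule card_poly_roots_bound) (use assms in auto)
  also have "\<dots> \<le> 2" by simp
  finally show ?thesis by (simp add: char2)
qed


subsection \<open>Value distribution of non-degenerate quadratic forms\<close>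

lemma add_eq_iff: "(x::'a) + y = k \<longleftrightarrow> x = k + y"
  by (auto simp: add.assoc)

lemma card_pairs:
  fixes R :: "'b::finite \<Rightarrow> 'c::finite \<Rightarrow> bool"
  shows "card {(x, y). R x y} = (\<Sum>y\<in>UNIV. card {x. R x y})"
proof -
  have "card {(x, y). R x y} = (\<Sum>y\<in>UNIV. card {p \<in> {(x, y). R x y}. snd p = y})"
    by (rule card_eq_sum_fibres) auto
  also have "\<dots> = (\<Sum>y\<in>UNIV. card {x. R x y})"
  proof (rule sum.cong)
    fix y
    have "{p \<in> {(x, y). R x y}. snd p = y} = (\<lambda>x. (x, y)) ` {x. R x y}" by auto
    then show "card {p \<in> {(x, y). R x y}. snd p = y} = card {x. R x y}"
      by (simp add: card_image inj_on_def)
  qed simp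
  finally show ?thesis .
qed

text \<open>Counting the pairs \<open>(v, w)\<close> with \<open>S v = S w\<close> once by the common value and once by \<open>w - v\<close>
  gives the second moment of the distribution of \<open>S\<close>. Since all non-zero values are equally
  frequent, the first two moments determine the distribution up to the sign of \<open>E\<close>.\<close>

lemma value_distribution:
  fixes S :: "'v::{finite,ab_group_add} \<Rightarrow> 'a" and B :: "'v \<Rightarrow> 'v \<Rightarrow> 'a" and M :: nat
  assumes S_add: "\<And>v u. S (v + u) = S v + S u + B v u"
    and S_K: "\<And>v. S v \<in> K"
    and B_equi: "\<And>u k. u \<noteq> 0 \<Longrightarrow> k \<in> K \<Longrightarrow> q * card {v. B v u = k} = M\<^sup>2"
    and scale: "\<And>k. k \<in> K \<Longrightarrow> k \<noteq> 0 \<Longrightarrow> card {v. S v = k} = card {v. S v = 1}"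
    and card_V: "CARD('v) = M\<^sup>2"
  obtains E :: int where "E = int M \<or> E = - int M"
    "int q * int (card {v. S v = 0}) = (int M)\<^sup>2 + (int q - 1) * E"
    "\<And>k. k \<in> K \<Longrightarrow> k \<noteq> 0 \<Longrightarrow> int q * int (card {v. S v = k}) = (int M)\<^sup>2 - E"
proof -
  define n0 n1 where "n0 = int (card {v. S v = 0})" and "n1 = int (card {v. S v = 1})"
  define PP where "PP = {(v, w). S v = S w}"
  have scale': "int (card {v. S v = k}) = n1" if "k \<in> K" "k \<noteq> 0" for k
    using scale[OF that] by (simp add: n1_def)
  have sumK: "(\<Sum>k\<in>K. g k) = g 0 + (int q - 1) * g1"
    if "\<And>k. k \<in> K \<Longrightarrow> k \<noteq> 0 \<Longrightarrow> g k = g1" for g :: "'a \<Rightarrow> int" and g1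
  proof -
    have "(\<Sum>k\<in>K. g k) = g 0 + (\<Sum>k\<in>K - {0}. g k)"
      by (rule sum.remove) auto
    also have "(\<Sum>k\<in>K - {0}. g k) = (\<Sum>k\<in>K - {0}. g1)"
      by (rule sum.cong) (use that in auto)
    also have "\<dots> = (int q - 1) * g1"
      using q_ge_2 by (simp add: card_Diff_subset card_K of_nat_diff)
    finally show ?thesis .
  qed
  have "CARD('v) = (\<Sum>k\<in>K. card {v\<in>UNIV. S v = k})"
    by (rule card_eq_sum_fibres) (use S_K in auto)
  then have "(int M)\<^sup>2 = (\<Sum>k\<in>K. int (card {v. S v = k}))"
    by (simp add: card_V flip: of_nat_sum of_nat_power)
  also have "\<dots> = n0 + (int q - 1) * n1"
    unfolding n0_def by (rule sumK) (simp add: scale')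
  finally have m1: "n0 + (int q - 1) * n1 = (int M)\<^sup>2" by simp
  have "card PP = (\<Sum>k\<in>K. card {p\<in>PP. S (fst p) = k})"
    by (rule card_eq_sum_fibres) (use S_K in auto)
  also have "\<dots> = (\<Sum>k\<in>K. card ({v. S v = k} \<times> {v. S v = k}))"
    by (intro sum.cong arg_cong[where f = card]) (auto simp: PP_def)
  finally have "int (card PP) = (\<Sum>k\<in>K. (int (card {v. S v = k}))\<^sup>2)"
    by (simp add: card_cartesian_product power2_eq_square)
  also have "\<dots> = n0\<^sup>2 + (int q - 1) * n1\<^sup>2"
    unfolding n0_def by (rule sumK) (simp add: scale')
  finally have m2: "int (card PP) = n0\<^sup>2 + (int q - 1) * n1\<^sup>2" .
  \<comment> \<open>Fixing the difference \<open>u\<close> cancels \<open>S v\<close> and leaves a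
    condition on \<open>B v u\<close> alone, which \<open>B_equi\<close> counts for
    \<open>u \<noteq> 0\<close>.\<close>
  have fibre: "card {p\<in>PP. snd p - fst p = u} = card {v. B v u = S u}" for u
  proof -
    have "S (v + u) = S v \<longleftrightarrow> B v u = S u" for v
      by (auto simp: S_add add.assoc add_eq_0_iff_eq)
    moreover have "w - v = u \<longleftrightarrow> w = v + u" for v w
      by (metis add.commute diff_add_cancel add_diff_cancel_right')
    ultimately have "{p\<in>PP. snd p - fst p = u} = (\<lambda>v. (v, v + u)) ` {v. B v u = S u}"
      by (force simp: PP_def)
    then show ?thesis by (simp add: card_image inj_on_def)
  qed
  have "card PP = (\<Sum>u\<in>UNIV. card {p\<in>PP. snd p - fst p = u})"
    by (rule card_eq_sum_fibres) auto
  also have "\<dots> = (\<Sum>u\<in>UNIV. card {v. B v u = S u})" by (simp add: fibre)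
  also have "\<dots> = card {v. B v 0 = S 0} + (\<Sum>u\<in>UNIV - {0}. card {v. B v u = S u})"
    by (rule sum.remove) auto
  finally have "q * card PP = q * card {v. B v 0 = S 0} + (\<Sum>u\<in>UNIV - {0}. q * card {v. B v u = S u})"
    by (simp add: distrib_left sum_distrib_left)
  also have "{v. B v 0 = S 0} = UNIV"
  proof -
    have "B v 0 = S 0" for v
      using S_add[of v 0] by (auto simp: add.assoc add_eq_0_iff_eq)
    then show ?thesis by auto
  qed
  also have "(\<Sum>u\<in>UNIV - {0}. q * card {v. B v u = S u}) = (\<Sum>u\<in>(UNIV::'v set) - {0}. M\<^sup>2)"
    by (rule sum.cong) (use B_equi S_K in auto)
  also have "\<dots> = (M\<^sup>2 - 1) * M\<^sup>2" by (simp add: card_Diff_subset card_V)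
  finally have "int q * int (card PP) = int q * (int M)\<^sup>2 + (int (M\<^sup>2) - 1) * (int M)\<^sup>2"
  proof -
    assume *: "q * card PP = q * CARD('v) + (M\<^sup>2 - 1) * M\<^sup>2"
    have "M\<^sup>2 \<ge> 1" using card_V[symmetric] zero_less_card_finite[where 'a = 'v] by linarith
    then show ?thesis
      using arg_cong[OF *, of int] by (simp add: card_V of_nat_diff)
  qed
  then have m3: "int q * (n0\<^sup>2 + (int q - 1) * n1\<^sup>2) = int q * (int M)\<^sup>2 + ((int M)\<^sup>2 - 1) * (int M)\<^sup>2"
    by (simp add: m2)
  \<comment> \<open>\<open>E\<close> measures the deviation of \<open>q n1\<close> from its value in
    a uniform distribution.\<close>
  define E where "E = (int M)\<^sup>2 - int q * n1"
  have qn1: "int q * n1 = (int M)\<^sup>2 - E" by (simp add: E_def)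
  have n0: "n0 = (int M)\<^sup>2 - (int q - 1) * n1" using m1 by simp
  have qn0: "int q * n0 = (int M)\<^sup>2 + (int q - 1) * E"
    unfolding n0 E_def by (simp add: algebra_simps)
  have "int q * (int q * (n0\<^sup>2 + (int q - 1) * n1\<^sup>2)) = (int q * n0)\<^sup>2 + (int q - 1) * (int q * n1)\<^sup>2"
    by (simp add: algebra_simps power2_eq_square)
  then have "((int M)\<^sup>2 + (int q - 1) * E)\<^sup>2 + (int q - 1) * ((int M)\<^sup>2 - E)\<^sup>2
      = int q * (int q * (int M)\<^sup>2 + ((int M)\<^sup>2 - 1) * (int M)\<^sup>2)"
    unfolding qn0 qn1 m3 by simp
  \<comment> \<open>The terms linear in \<open>E\<close> cancel in the second moment.\<close>
  then have "int q * (int q - 1) * E\<^sup>2 = int q * (int q - 1) * (int M)\<^sup>2"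
    by (simp add: algebra_simps power2_eq_square)
  then have "E\<^sup>2 = (int M)\<^sup>2" using q_ge_2 by simp
  then have "E = int M \<or> E = - int M" by (simp add: power2_eq_iff)
  then show ?thesis
    using that[of E] qn0 qn1 by (simp add: scale' n0_def)
qed

section \<open>Trace equations in two variables and the four-variable quadratic form over
  \<open>K\<close>\<close>

lemma card_tr_pair_fibre:
  assumes "k \<in> K" "a \<noteq> 0 \<or> b \<noteq> 0"
  shows "card {(x, y). tr (a * x + b * y) = k} = q ^ 3"
proof -
  have *: "card {(x, y). tr (a * x + b * y) = k} = q ^ 3" if "a \<noteq> 0" for a b
  proof -
    have "card {x. tr (a * x + b * y) = k} = q" for y
    proof -
      have "tr (a * x + b * y) = k \<longleftrightarrow> tr (a * x) = k + tr (b * y)" for x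
        by (simp add: tr_add add_eq_iff)
      then show ?thesis using card_tr_mult_fibre[of "k + tr (b * y)" a] assms(1) that by auto
    qed
    then show ?thesis by (simp add: card_pairs card_field power2_eq_square power3_eq_cube)
  qed
  show ?thesis
  proof (cases "a = 0")
    case True
    have "card {(x, y). tr (a * x + b * y) = k} = card {(y, x). tr (b * y + a * x) = k}"
      by (rule bij_betw_same_card[of prod.swap], rule bij_betwI[where g = prod.swap])
        (auto simp: add.commute)
    then show ?thesis using *[of b a] assms True by simp
  qed (use * in simp)
qed

definition sform :: "'a \<Rightarrow> 'a \<Rightarrow> 'a \<Rightarrow> 'a \<times> 'a \<Rightarrow> 'a" where
  "sform a b c = (\<lambda>(x, y). tr (a * x\<^sup>2 + b * y\<^sup>2 + c * x * y) + nm x + nm y)"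

definition affine_points :: "'a \<Rightarrow> 'a \<Rightarrow> 'a \<Rightarrow> 'a \<Rightarrow> 'a \<Rightarrow> 'a \<Rightarrow> ('a \<times> 'a) set" where
  "affine_points a b c d e f =
    {(x, y). tr (a * x\<^sup>2 + b * y\<^sup>2 + c * x * y + d * x + e * y + f) = nm x + nm y}"

text \<open>The terms with \<open>a\<close> and \<open>b\<close> are additive and drop out;
  conjugation inside the trace collects the mixed terms of the norms as coefficients of
  \<open>v\<close>.\<close>

lemma sform_add:
  "sform a b c (v + u) = sform a b c v + sform a b c u +
     tr ((c * snd u + cj (fst u)) * fst v + (c * fst u + cj (snd u)) * snd v)"
  by (cases v; cases u) (simp add: sform_def tr_def nm_def char2)

lemma sform_in_K: "sform a b c v \<in> K"
  by (cases v) (auto simp: sform_def)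

lemma sform_scale:
  assumes "s \<in> K"
  shows "sform a b c (s * x, s * y) = s\<^sup>2 * sform a b c (x, y)"
  using assms by (simp add: sform_def tr_def nm_def K_def char2)

text \<open>A radical vector \<open>(u1, u2)\<close> satisfies \<open>cj u1 = c u2\<close> and
  \<open>cj u2 = c u1\<close>, so \<open>u2 = nm c * u2\<close>; thus the radical is zero for
  \<open>nm c \<noteq> 1\<close>. The second moment applies with \<open>M = q\<^sup>2\<close>, as
  there are \<open>q ^ 4\<close> pairs.\<close>

lemma sform_distribution:
  assumes "nm c \<noteq> 1"
  obtains E where "E = (int q)\<^sup>2 \<or> E = - (int q)\<^sup>2"
    "int q * int (card {v. sform a b c v = 0}) = (int q) ^ 4 + (int q - 1) * E"
    "\<And>k. k \<in> K \<Longrightarrow> k \<noteq> 0 \<Longrightarrow> int q * int (card {v. sform a b c v = k}) = (int q) ^ 4 - E"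
proof -
  have equi: "q * card {v. tr ((c * snd u + cj (fst u)) * fst v + (c * fst u + cj (snd u)) * snd v) = k}
      = (q\<^sup>2)\<^sup>2" if "u \<noteq> 0" "k \<in> K" for u :: "'a \<times> 'a" and k
  proof -
    have "c * snd u + cj (fst u) \<noteq> 0 \<or> c * fst u + cj (snd u) \<noteq> 0"
    proof (rule ccontr)
      assume "\<not> ?thesis"
      then have 1: "cj (fst u) = c * snd u" and 2: "cj (snd u) = c * fst u"
        by (auto simp: add_eq_0_iff_eq)
      have "snd u = cj c * (c * snd u)" using arg_cong[OF 2, of cj] 1 by simp
      then have "snd u = nm c * snd u" by (simp add: nm_def mult_ac)
      then have "snd u = 0" using assms by simp
      then have "fst u = 0" using 1 by simp
      then show False using \<open>snd u = 0\<close> \<open>u \<noteq> 0\<close> by (simp add: prod_eq_iff)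
    qed
    from card_tr_pair_fibre[OF \<open>k \<in> K\<close> this] show ?thesis
      by (simp add: case_prod_beta' flip: power_Suc power_mult)
  qed
  have scale: "card {v. sform a b c v = k} = card {v. sform a b c v = 1}" if k: "k \<in> K" "k \<noteq> 0" for k
  proof -
    obtain s where s: "s \<in> K" "s\<^sup>2 = k" using sqrt_K k by metis
    then have "s \<noteq> 0" "inverse s \<in> K" using k by (auto simp: K_def cj_inverse)
    then show ?thesis
      by (intro bij_betw_same_card[of "\<lambda>(x, y). (inverse s * x, inverse s * y)"]
          bij_betwI[where g = "\<lambda>(x, y). (s * x, s * y)"])
        (use s k in \<open>auto simp: sform_scale power_inverse simp flip: mult.assoc\<close>)
  qed
  have card: "CARD('a \<times> 'a) = (q\<^sup>2)\<^sup>2" by (simp add: card_field power2_eq_square)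
  obtain E where "E = int (q\<^sup>2) \<or> E = - int (q\<^sup>2)"
    "int q * int (card {v. sform a b c v = 0}) = (int (q\<^sup>2))\<^sup>2 + (int q - 1) * E"
    "\<And>k. k \<in> K \<Longrightarrow> k \<noteq> 0 \<Longrightarrow> int q * int (card {v. sform a b c v = k}) = (int (q\<^sup>2))\<^sup>2 - E"
    by (rule value_distribution[where M = "q\<^sup>2", OF sform_add sform_in_K equi scale card])
      (assumption | rule that)+
  then show ?thesis using that[of E] by simp
qed

text \<open>Completing the square: \<open>v0\<close> is chosen so that the polar form with
  \<open>v0\<close> is the linear part given by \<open>d\<close> and \<open>e\<close>. It exists
  because the additive map \<open>T\<close> has trivial kernel on a finite set.\<close>

lemma sform_translate:
  assumes "nm c \<noteq> 1"
  obtains k where "k \<in> K" "card (affine_points a b c d e f) = card {v. sform a b c v = k}"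
proof -
  define T :: "'a \<times> 'a \<Rightarrow> 'a \<times> 'a" where "T = (\<lambda>(x, y). (c * y + cj x, c * x + cj y))"
  have "inj T"
  proof (rule injI)
    fix v u assume "T v = T u"
    define x y where "x = fst v + fst u" and "y = snd v + snd u"
    have "c * y + cj x = 0" "c * x + cj y = 0"
      using \<open>T v = T u\<close> by (auto simp: T_def x_def y_def char2 add_eq_0_iff_eq split: prod.splits)
    then have 1: "cj x = c * y" and 2: "cj y = c * x" by (auto simp: add_eq_0_iff_eq)
    have "y = nm c * y" using arg_cong[OF 2, of cj] 1 by (simp add: nm_def mult_ac)
    then have "y = 0" using assms by simp
    moreover from this have "x = 0" using 1 by simp
    ultimately show "v = u" by (auto simp: x_def y_def add_eq_0_iff_eq prod_eq_iff)
  qed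
  then have "surj T" by (simp add: finite_UNIV_inj_surj)
  then obtain v0 where v0: "T v0 = (d, e)" by (metis surjE)
  define k where "k = sform a b c v0 + tr f"
  have iff: "v \<in> affine_points a b c d e f \<longleftrightarrow> sform a b c (v + v0) = k" for v
  proof -
    have "d = c * snd v0 + cj (fst v0)" "e = c * fst v0 + cj (snd v0)"
      using v0 by (auto simp: T_def split: prod.splits)
    then have "sform a b c (v + v0) = sform a b c v + sform a b c v0 + tr (d * fst v + e * snd v)"
      by (simp only: sform_add)
    then have "sform a b c (v + v0) = k \<longleftrightarrow> sform a b c v + tr (d * fst v + e * snd v) + tr f = 0"
      unfolding k_def by (subst add_eq_0_iff_eq[symmetric]) (simp add: ac_simps)
    also have "\<dots> \<longleftrightarrow> v \<in> affine_points a b c d e f"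
    proof (cases v)
      case (Pair x y)
      have "v \<in> affine_points a b c d e f \<longleftrightarrow>
          tr (a * x\<^sup>2 + b * y\<^sup>2 + c * x * y + d * x + e * y + f) + (nm x + nm y) = 0"
        by (simp add: affine_points_def Pair add_eq_0_iff_eq)
      then show ?thesis by (simp add: Pair sform_def tr_add ac_simps)
    qed
    finally show ?thesis by simp
  qed
  have "card (affine_points a b c d e f) = card {v. sform a b c v = k}"
    by (rule bij_betw_same_card[of "\<lambda>v. v + v0"], rule bij_betwI[where g = "\<lambda>v. v - v0"])
      (auto simp: iff)
  moreover have "k \<in> K" by (auto simp: k_def sform_in_K)
  ultimately show ?thesis using that by blast
qed

text \<open>The four values come from \<open>E = q\<^sup>2\<close> or
  \<open>E = - q\<^sup>2\<close>, each with \<open>k = 0\<close> or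
  \<open>k \<noteq> 0\<close>.\<close>

lemma card_affine_nondegenerate:
  assumes "nm c \<noteq> 1"
  shows "int (card (affine_points a b c d e f)) \<in>
    {int q ^ 3 + int q ^ 2 - int q, int q ^ 3 - int q ^ 2 + int q, int q ^ 3 - int q, int q ^ 3 + int q}"
proof -
  obtain k where k: "k \<in> K" "card (affine_points a b c d e f) = card {v. sform a b c v = k}"
    using sform_translate[OF assms] by metis
  define n where "n = int (card {v. sform a b c v = k})"
  obtain E where E: "E = (int q)\<^sup>2 \<or> E = - (int q)\<^sup>2"
    "int q * int (card {v. sform a b c v = 0}) = (int q) ^ 4 + (int q - 1) * E"
    "\<And>k. k \<in> K \<Longrightarrow> k \<noteq> 0 \<Longrightarrow> int q * int (card {v. sform a b c v = k}) = (int q) ^ 4 - E"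
    by (rule sform_distribution[OF assms, of a b]) (rule that)
  have "int q * n = (int q) ^ 4 + (int q - 1) * E \<or> int q * n = (int q) ^ 4 - E"
    using E k(1) by (cases "k = 0") (auto simp: n_def)
  then have "int q * n = int q * (int q ^ 3 + int q ^ 2 - int q) \<or>
     int q * n = int q * (int q ^ 3 - int q ^ 2 + int q) \<or>
     int q * n = int q * (int q ^ 3 - int q) \<or> int q * n = int q * (int q ^ 3 + int q)"
    using E(1) by (auto simp: algebra_simps power2_eq_square power3_eq_cube power4_eq_xxxx)
  then show ?thesis using q_ge_2 k(2) by (simp add: n_def)
qed


subsection \<open>Affine points when the tangent cones share a line\<close>

lemma card_tr_mult_fibre_cases:
  assumes "k \<in> K"
  shows "card {x. tr (g * x) = k} = (if g = 0 then (if k = 0 then q\<^sup>2 else 0) else q)"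
  using assms by (auto simp: card_tr_mult_fibre card_field)

text \<open>A common line \<open>y = t x\<close> of the two tangent cones in the plane \<open>J = 0\<close> makes the equation
  affine in \<open>x\<close> after the substitution \<open>y = Y + t x\<close>.\<close>

lemma card_affine_isotropic:
  fixes a b c d e f t
  assumes t: "nm t = 1" "a + c * t + b * t\<^sup>2 = 0"
  defines "Z \<equiv> {Y. c * Y + t * cj Y = d + e * t}"
    and "W \<equiv> \<lambda>Y. tr (b * Y\<^sup>2 + e * Y + f) + nm Y"
  shows "int (card (affine_points a b c d e f)) =
    int q ^ 3 - int q * int (card Z) + int q ^ 2 * int (card {Y\<in>Z. W Y = 0})"
proof -
  define g where "g Y = c * Y + t * cj Y + (d + e * t)" for Y
  have g0: "g Y = 0 \<longleftrightarrow> Y \<in> Z" for Y by (simp add: g_def Z_def add_eq_0_iff_eq)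
  \<comment> \<open>The root equation removes \<open>x\<^sup>2\<close>, and \<open>nm t = 1\<close>
    makes the two copies of \<open>nm x\<close> cancel.\<close>
  have iff: "(x, Y + t * x) \<in> affine_points a b c d e f \<longleftrightarrow> tr (g Y * x) = W Y" for x Y
  proof -
    define y where "y = Y + t * x"
    have 1: "a * x\<^sup>2 + b * y\<^sup>2 + c * x * y = (a + c * t + b * t\<^sup>2) * x\<^sup>2 + b * Y\<^sup>2 + c * x * Y"
      by (simp add: y_def char2)
    have 2: "nm y = nm Y + nm t * nm x + tr (t * x * cj Y)"
      by (simp add: y_def nm_def tr_def char2)
    have "(x, y) \<in> affine_points a b c d e f \<longleftrightarrow>
        tr (a * x\<^sup>2 + b * y\<^sup>2 + c * x * y + d * x + e * y + f) + (nm x + nm y) = 0"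
      by (simp add: affine_points_def add_eq_0_iff_eq)
    also have "tr (a * x\<^sup>2 + b * y\<^sup>2 + c * x * y + d * x + e * y + f) + (nm x + nm y) = tr (g Y * x) + W Y"
      unfolding 1 2 t
      by (simp add: y_def g_def W_def tr_def char2)
    finally show ?thesis by (simp add: y_def add_eq_0_iff_eq)
  qed
  have WK: "W Y \<in> K" for Y by (simp add: W_def)
  have "card (affine_points a b c d e f) = card {(x, Y). tr (g Y * x) = W Y}"
    by (rule bij_betw_same_card[of "\<lambda>(x, y). (x, y + t * x)"],
        rule bij_betwI[where g = "\<lambda>(x, Y). (x, Y + t * x)"])
      (auto simp: add.assoc iff simp flip: iff)
  \<comment> \<open>For \<open>Y\<close> in \<open>Z\<close> the coefficient of \<open>x\<close>
    vanishes, so every \<open>x\<close> works or none does.\<close>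
  also have "\<dots> = (\<Sum>Y\<in>UNIV. if Y \<in> Z then (if W Y = 0 then q\<^sup>2 else 0) else q)"
    by (simp only: card_pairs card_tr_mult_fibre_cases[OF WK] g0)
  also have "\<dots> = (\<Sum>Y\<in>Z. if W Y = 0 then q\<^sup>2 else 0) + (\<Sum>Y\<in>-Z. q)"
    by (simp add: sum.If_cases Compl_eq)
  also have "(\<Sum>Y\<in>Z. if W Y = 0 then q\<^sup>2 else 0) = q\<^sup>2 * card {Y\<in>Z. W Y = 0}"
    by (simp add: sum.If_cases Int_def)
  finally have *: "card (affine_points a b c d e f) = q\<^sup>2 * card {Y\<in>Z. W Y = 0} + card (- Z) * q"
    by simp
  have "card Z \<le> q\<^sup>2" using card_mono[of UNIV Z] by (simp add: card_field)
  then have "int (card (- Z)) = (int q)\<^sup>2 - int (card Z)"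
    by (simp add: Compl_eq_Diff_UNIV card_Diff_subset card_field of_nat_diff)
  then show ?thesis
    by (simp add: * left_diff_distrib power2_eq_square power3_eq_cube)
qed

text \<open>A kernel vector of \<open>Y \<mapsto> c Y + t cj Y\<close> satisfies
  \<open>nm c * nm Y = nm Y\<close>, so the map is bijective and the coefficient of \<open>x\<close>
  vanishes for exactly one \<open>Y\<close>.\<close>

lemma card_affine_isotropic_nondegenerate:
  assumes t: "nm t = 1" "a + c * t + b * t\<^sup>2 = 0" and c: "nm c \<noteq> 1"
  shows "int (card (affine_points a b c d e f)) \<in> {int q ^ 3 - int q, int q ^ 3 + int q ^ 2 - int q}"
proof -
  define T where "T Y = c * Y + t * cj Y" for Y
  have "inj T"
  proof (rule injI)
    fix Y Y' assume "T Y = T Y'"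
    then have "c * (Y + Y') + t * cj (Y + Y') = 0"
      by (simp add: T_def char2 add_eq_0_iff_eq)
    then have "nm c * nm (Y + Y') = nm t * nm (Y + Y')"
      by (metis add_eq_0_iff_eq nm_cj nm_mult)
    then have "nm (Y + Y') = 0" using t(1) c by auto
    then show "Y = Y'" by (simp add: add_eq_0_iff_eq)
  qed
  then have "bij T" by (simp add: bij_def finite_UNIV_inj_surj)
  then obtain Y1 where "T Y1 = d + e * t" by (metis bij_pointE)
  then have "T Y = d + e * t \<longleftrightarrow> Y = Y1" for Y
    using inj_eq[OF \<open>inj T\<close>, of Y Y1] by metis
  then have Z: "{Y. c * Y + t * cj Y = d + e * t} = {Y1}"
    by (auto simp: T_def)
  show ?thesis
    using card_affine_isotropic[OF t, of d e f] unfolding Z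
    by (auto simp: Collect_conv_if)
qed

lemma hilbert90:
  assumes "nm r = 1"
  obtains y where "y \<noteq> 0" "y = r * cj y"
proof -
  obtain x where x: "tr x = 1" using tr_surj[of 1] by auto
  \<comment> \<open>\<open>z = 1\<close> gives \<open>1 + r\<close>, which vanishes only for
    \<open>r = 1\<close>; an element of trace 1 serves then.\<close>
  define z where "z = (if r = 1 then x else 1)"
  have "z + r * cj z \<noteq> 0"
    using x by (auto simp: z_def tr_def add_eq_0_iff_eq)
  moreover have "r * cj (z + r * cj z) = z + r * cj z"
    using assms by (simp add: nm_def distrib_left mult.assoc[symmetric] add.commute)
  ultimately show ?thesis using that by metis
qed

text \<open>\<open>Z\<close> is empty or a coset of a line \<open>K Y0\<close>, on which
  \<open>W\<close> is a polynomial of degree at most 2 in a parameter from \<open>K\<close>. Its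
  coefficient \<open>A\<close> of the square vanishes exactly when \<open>tr (b t cj c) = 1\<close>.
  Each of its \<open>r\<close> zeros contributes \<open>q\<^sup>2\<close> points.\<close>

lemma card_affine_isotropic_degenerate:
  assumes t: "nm t = 1" "a + c * t + b * t\<^sup>2 = 0" and c: "nm c = 1"
  defines "q' \<equiv> int q"
  shows "tr (b * t * cj c) \<noteq> 1 \<Longrightarrow>
      int (card (affine_points a b c d e f)) \<in> {q' ^ 3, q' ^ 3 - q' ^ 2, q' ^ 3 + q' ^ 2}" (is "_ \<Longrightarrow> ?A")
    and "tr (b * t * cj c) = 1 \<Longrightarrow>
      int (card (affine_points a b c d e f)) \<in> {q' ^ 3, q' ^ 3 - q' ^ 2, 2 * q' ^ 3 - q' ^ 2}" (is "_ \<Longrightarrow> ?B")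
proof -
  define Z where "Z = {Y. c * Y + t * cj Y = d + e * t}"
  define W where "W Y = tr (b * Y\<^sup>2 + e * Y + f) + nm Y" for Y
  have card: "int (card (affine_points a b c d e f)) =
      q' ^ 3 - q' * int (card Z) + q' ^ 2 * int (card {Y\<in>Z. W Y = 0})"
    unfolding Z_def W_def q'_def by (rule card_affine_isotropic[OF t])
  have c0: "c \<noteq> 0" and t0: "t \<noteq> 0" using c t by (auto simp: nm_def)
  have "nm (t / c) = 1" using t c by (simp add: nm_divide)
  \<comment> \<open>\<open>Y0\<close> spans the kernel of \<open>Y \<mapsto> c Y + t cj Y\<close>
    over \<open>K\<close>.\<close>
  then obtain Y0 where Y0: "Y0 \<noteq> 0" "Y0 = t / c * cj Y0" by (rule hilbert90)
  have cY0: "c * Y0 = t * cj Y0" using Y0(2) c0 by (simp add: field_simps)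
  define A where "A = nm Y0 + tr (b * Y0\<^sup>2)"
  have A: "A = nm Y0 * (1 + tr (b * t * cj c))"
  proof -
    have eq: "Y0 = t * cj c * cj Y0"
    proof -
      have "c * cj c = 1" using c by (simp add: nm_def)
      then have "cj c = 1 / c" using c0 by (simp add: field_simps)
      then show ?thesis using Y0(2) by simp
    qed
    have "b * Y0\<^sup>2 = b * Y0 * Y0" by (simp add: power2_eq_square)
    also have "\<dots> = b * Y0 * (t * cj c * cj Y0)"
      using arg_cong[OF eq, of "\<lambda>z. b * Y0 * z"] .
    also have "\<dots> = nm Y0 * (b * t * cj c)" by (simp add: nm_def mult_ac)
    finally have bY0: "b * Y0\<^sup>2 = nm Y0 * (b * t * cj c)" .
    show ?thesis unfolding A_def bY0 by (simp add: tr_K_mult distrib_left)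
  qed
  have goals: "(tr (b * t * cj c) \<noteq> 1 \<longrightarrow> ?A) \<and> (tr (b * t * cj c) = 1 \<longrightarrow> ?B)"
  proof (cases "Z = {}")
    case True
    then show ?thesis using card by simp
  next
    case False
    then obtain Y1 where Y1: "Y1 \<in> Z" by auto
    have inj: "inj_on (\<lambda>s. Y1 + s * Y0) S" for S using Y0(1) by (auto simp: inj_on_def)
    have Z: "Z = (\<lambda>s. Y1 + s * Y0) ` K"
    proof (intro equalityI subsetI)
      fix Y assume "Y \<in> Z"
      then have "c * Y + t * cj Y = c * Y1 + t * cj Y1" using Y1 by (simp add: Z_def)
      then have "c * (Y + Y1) + t * cj (Y + Y1) = 0"
        by (simp add: char2)
      then have 1: "c * (Y + Y1) = t * cj (Y + Y1)" by (simp add: add_eq_0_iff_eq)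
      define s where "s = (Y + Y1) / Y0"
      have YY: "Y + Y1 = s * Y0" using Y0 by (simp add: s_def)
      have "s * (c * Y0) = cj s * (t * cj Y0)" using 1 unfolding YY by (simp add: mult_ac)
      then have "s = cj s" using cY0 t0 Y0(1) by simp
      then have "s \<in> K" by (simp add: K_def)
      moreover have "Y = Y1 + s * Y0" using YY by (metis add.commute add_self_left)
      ultimately show "Y \<in> (\<lambda>s. Y1 + s * Y0) ` K" by blast
    next
      fix Y assume "Y \<in> (\<lambda>s. Y1 + s * Y0) ` K"
      then obtain s where s: "s \<in> K" "Y = Y1 + s * Y0" by auto
      have "c * Y + t * cj Y = c * Y1 + t * cj Y1 + s * (c * Y0 + t * cj Y0)"
        using s by (simp add: K_def algebra_simps)
      then show "Y \<in> Z" using Y1 cY0 by (simp add: Z_def)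
    qed
    have cardZ: "card Z = q" unfolding Z using inj by (simp add: card_image card_K)
    define L where "L = tr (e * Y0 + cj Y1 * Y0)"
    have W: "W (Y1 + s * Y0) = A * s\<^sup>2 + L * s + W Y1" if "s \<in> K" for s
      using that by (simp add: W_def A_def L_def tr_def nm_def K_def char2)
    define r where "r = card {s\<in>K. A * s\<^sup>2 + L * s + W Y1 = 0}"
    have "{Y\<in>Z. W Y = 0} = (\<lambda>s. Y1 + s * Y0) ` {s\<in>K. A * s\<^sup>2 + L * s + W Y1 = 0}"
      using W by (auto simp: Z)
    then have "card {Y\<in>Z. W Y = 0} = r" using inj by (simp add: card_image r_def)
    then have n: "int (card (affine_points a b c d e f)) = q' ^ 3 - q' ^ 2 + q' ^ 2 * int r"
      using card cardZ by (simp add: q'_def power2_eq_square)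
    have r2: "r \<le> 2" if "A \<noteq> 0 \<or> L \<noteq> 0"
      unfolding r_def using card_quadratic_le[OF that, of "W Y1"]
      by (rule order.trans[rotated]) (auto intro: card_mono)
    show ?thesis
    proof (intro conjI impI)
      assume "tr (b * t * cj c) \<noteq> 1"
      then have "A \<noteq> 0" using Y0(1) by (auto simp: A add_eq_0_iff_eq)
      then have "r \<in> {0, 1, 2}" using r2 by auto
      then show ?A using n by (auto simp: algebra_simps)
    next
      assume "tr (b * t * cj c) = 1"
      then have A0: "A = 0" by (simp add: A)
      \<comment> \<open>\<open>r = q\<close> occurs when the polynomial vanishes identically; it
        accounts for \<open>2 q\<^sup>3 - q\<^sup>2\<close>.\<close>
      have "r \<in> {0, 1, q}"
      proof (cases "L = 0")
        case True
        then show ?thesis by (cases "W Y1 = 0") (simp_all add: r_def A0 card_K)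
      next
        case False
        then have "{s\<in>K. A * s\<^sup>2 + L * s + W Y1 = 0} \<subseteq> {W Y1 / L}"
          by (auto simp: A0 add_eq_0_iff_eq field_simps)
        then have "r \<le> 1" unfolding r_def by (metis card.empty card_insert_disjoint card_mono finite.intros empty_iff One_nat_def)
        then show ?thesis by auto
      qed
      then show ?B using n by (auto simp: q'_def algebra_simps power2_eq_square power3_eq_cube)
    qed
  qed
  show "tr (b * t * cj c) \<noteq> 1 \<Longrightarrow> ?A" and "tr (b * t * cj c) = 1 \<Longrightarrow> ?B" using goals by auto
qed


subsection \<open>Affine points when the polar form is degenerate\<close>

text \<open>A binary quadratic form over \<open>K\<close>, used with \<open>\<beta> = cj b\<close>
  in the coordinate \<open>X = c x + cj y\<close> of the case \<open>nm c = 1\<close>.\<close>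

definition gform :: "'a \<Rightarrow> 'a \<Rightarrow> 'a" where "gform \<beta> X = nm X + tr (\<beta> * X\<^sup>2)"

lemma gform_add: "gform \<beta> (X + Y) = gform \<beta> X + gform \<beta> Y + tr (cj Y * X)"
  by (simp add: gform_def tr_def nm_def char2)

lemma gform_in_K [simp]: "gform \<beta> X \<in> K"
  by (simp add: gform_def)

text \<open>The second moment with \<open>M = q\<close>. The sign \<open>\<epsilon>\<close> is the
  type of the form: 1 for \<open>2 q - 1\<close> zeros, -1 for the zero vector only.\<close>

lemma gform_distribution:
  obtains \<epsilon> :: int where "\<epsilon> = 1 \<or> \<epsilon> = -1"
    "\<And>k. k \<in> K \<Longrightarrow> int (card {X. gform \<beta> X = k}) = int q - \<epsilon> + (if k = 0 then \<epsilon> * int q else 0)"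
proof -
  have equi: "q * card {X. tr (cj Y * X) = k} = q\<^sup>2" if "Y \<noteq> 0" "k \<in> K" for Y k
    using that by (simp add: card_tr_mult_fibre power2_eq_square)
  have scale: "card {X. gform \<beta> X = k} = card {X. gform \<beta> X = 1}" if k: "k \<in> K" "k \<noteq> 0" for k
  proof -
    obtain s where s: "s \<in> K" "s\<^sup>2 = k" using sqrt_K k by metis
    then have "s \<noteq> 0" "inverse s \<in> K" using k by (auto simp: K_def cj_inverse)
    moreover have "gform \<beta> (r * X) = r\<^sup>2 * gform \<beta> X" if "r \<in> K" for r X
      using that by (simp add: gform_def tr_def nm_def K_def char2)
    ultimately show ?thesis
      by (intro bij_betw_same_card[of "\<lambda>X. inverse s * X"] bij_betwI[where g = "\<lambda>X. s * X"])
        (use s k in \<open>auto simp: power_inverse simp flip: mult.assoc\<close>)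
  qed
  obtain E where E: "E = int q \<or> E = - int q"
    "int q * int (card {X. gform \<beta> X = 0}) = (int q)\<^sup>2 + (int q - 1) * E"
    "\<And>k. k \<in> K \<Longrightarrow> k \<noteq> 0 \<Longrightarrow> int q * int (card {X. gform \<beta> X = k}) = (int q)\<^sup>2 - E"
    by (rule value_distribution[where M = q, OF gform_add gform_in_K equi scale card_field])
      (assumption | rule that)+
  define \<epsilon> :: int where "\<epsilon> = (if E = int q then 1 else - 1)"
  have \<epsilon>: "\<epsilon> = 1 \<or> \<epsilon> = -1" "E = int q * \<epsilon>" using E(1) by (auto simp: \<epsilon>_def)
  have "int (card {X. gform \<beta> X = k}) = int q - \<epsilon> + (if k = 0 then \<epsilon> * int q else 0)" if "k \<in> K" for k
  proof -
    have "int q * int (card {X. gform \<beta> X = k}) = int q * (int q - \<epsilon> + (if k = 0 then \<epsilon> * int q else 0))"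
      using E(2) E(3)[OF that] by (simp add: \<epsilon>(2) algebra_simps power2_eq_square)
    then show ?thesis using q_ge_2 by simp
  qed
  then show ?thesis using that \<epsilon>(1) by blast
qed

text \<open>When \<open>c\<close> has norm 1 the polar form has a radical of dimension 2 over \<open>K\<close>, and the
  coordinate \<open>X = c x + y\<^sup>q\<close> on the quotient decouples from \<open>x\<close>.\<close>

lemma card_affine_decoupled:
  assumes c: "nm c = 1"
  obtains \<kappa> where "\<kappa> \<in> K" "card (affine_points a b c d e f) =
    (\<Sum>X\<in>UNIV. card {x. tr ((a + cj b * c\<^sup>2) * x\<^sup>2 + (d + cj e * c) * x) = gform (cj b) X + \<kappa>})"
proof -
  define \<gamma> \<delta> where "\<gamma> = a + cj b * c\<^sup>2" and "\<delta> = d + cj e * c"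
  \<comment> \<open>Translating \<open>X\<close> by \<open>e\<close> absorbs the linear term
    \<open>tr (cj e * X)\<close> at the cost of the constant \<open>gform (cj b) e\<close>.\<close>
  define \<kappa> where "\<kappa> = gform (cj b) e + tr f"
  have iff: "(x, cj (X + c * x)) \<in> affine_points a b c d e f \<longleftrightarrow>
      tr (\<gamma> * x\<^sup>2 + \<delta> * x) = gform (cj b) (X + e) + \<kappa>" for x X
  proof -
    define u where "u = c * x"
    define y where "y = cj (X + u)"
    have nmx: "nm x = nm u" using c by (simp add: u_def nm_mult)
    have b: "tr (b * y\<^sup>2) = tr (cj b * X\<^sup>2 + cj b * c\<^sup>2 * x\<^sup>2)"
    proof -
      have "tr (b * y\<^sup>2) = tr (cj b * (X + u)\<^sup>2)" by (simp add: y_def tr_def add.commute)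
      then show ?thesis by (simp add: sq_add u_def power_mult_distrib algebra_simps)
    qed
    have e: "tr (e * y) = tr (cj e * X + cj e * c * x)"
      by (simp add: y_def u_def tr_def algebra_simps)
    \<comment> \<open>Since \<open>nm x = nm u\<close>, the three terms complete to
      \<open>nm (u + cj y)\<close>, and \<open>u + cj y = X\<close>.\<close>
    have cxy: "tr (c * x * y) + nm x + nm y = nm X"
      unfolding nmx u_def[symmetric] y_def by (simp add: tr_def nm_def char2)
    have "(x, y) \<in> affine_points a b c d e f \<longleftrightarrow>
        tr (a * x\<^sup>2 + b * y\<^sup>2 + c * x * y + d * x + e * y + f) + (nm x + nm y) = 0"
      by (simp add: affine_points_def add_eq_0_iff_eq)
    also have "tr (a * x\<^sup>2 + b * y\<^sup>2 + c * x * y + d * x + e * y + f) + (nm x + nm y) =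
        tr (a * x\<^sup>2) + tr (b * y\<^sup>2) + (tr (c * x * y) + nm x + nm y) + tr (d * x) + tr (e * y) + tr f"
      by (simp only: tr_add ac_simps)
    also have "\<dots> = tr (\<gamma> * x\<^sup>2 + \<delta> * x) + (gform (cj b) (X + e) + \<kappa>)"
      unfolding b e cxy gform_add \<kappa>_def \<gamma>_def \<delta>_def
      by (simp add: gform_def tr_add algebra_simps)
    finally show ?thesis by (simp add: y_def u_def add_eq_0_iff_eq)
  qed
  have y_eq: "cj (c * x + cj y + c * x) = y" for x y
    by (metis add.assoc add.commute add_self_left cj_cj)
  have iff': "(x, y) \<in> affine_points a b c d e f \<longleftrightarrow>
      tr (\<gamma> * x\<^sup>2 + \<delta> * x) = gform (cj b) (c * x + cj y + e) + \<kappa>" for x y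
    using iff[of x "c * x + cj y"] by (simp only: y_eq)
  have XX: "c * x + cj (cj (X + e + c * x)) + e = X" for x X
    by (simp add: ac_simps)
  have "card (affine_points a b c d e f) =
      card {(x, X). tr (\<gamma> * x\<^sup>2 + \<delta> * x) = gform (cj b) X + \<kappa>}"
  proof (rule bij_betw_same_card, rule bij_betwI)
    show "(\<lambda>(x, y). (x, c * x + cj y + e)) \<in> affine_points a b c d e f \<rightarrow>
        {(x, X). tr (\<gamma> * x\<^sup>2 + \<delta> * x) = gform (cj b) X + \<kappa>}"
      using iff' by auto
    show "(\<lambda>(x, X). (x, cj (X + e + c * x))) \<in>
        {(x, X). tr (\<gamma> * x\<^sup>2 + \<delta> * x) = gform (cj b) X + \<kappa>} \<rightarrow> affine_points a b c d e f"
      by (auto simp only: iff' XX mem_Collect_eq split_beta fst_conv snd_conv Pi_iff)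
    show "(case case p of (x, y) \<Rightarrow> (x, c * x + cj y + e) of (x, X) \<Rightarrow> (x, cj (X + e + c * x))) = p" for p
    proof (cases p)
      case (Pair x y)
      have "c * x + cj y + e + e + c * x = cj y"
        by (simp add: add.assoc)
      then show ?thesis using Pair by simp
    qed
    show "(case case p of (x, X) \<Rightarrow> (x, cj (X + e + c * x)) of (x, y) \<Rightarrow> (x, c * x + cj y + e)) = p" for p
      using XX by (cases p) simp
  qed
  also have "\<dots> = (\<Sum>X\<in>UNIV. card {x. tr (\<gamma> * x\<^sup>2 + \<delta> * x) = gform (cj b) X + \<kappa>})"
    by (rule card_pairs)
  finally have card: "card (affine_points a b c d e f) =
    (\<Sum>X\<in>UNIV. card {x. tr (\<gamma> * x\<^sup>2 + \<delta> * x) = gform (cj b) X + \<kappa>})" .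
  have "\<kappa> \<in> K" by (simp add: \<kappa>_def)
  then show ?thesis using card unfolding \<gamma>_def \<delta>_def by (rule that)
qed

lemma card_fibre_of_surj:
  assumes add: "\<And>x y. T (x + y) = T x + (T y :: 'a)" and T_K: "\<And>x::'a. T x \<in> K"
    and surj: "\<And>k. k \<in> K \<Longrightarrow> \<exists>x. T x = k" and k: "k \<in> K"
  shows "card {x. T x = k} = q"
proof -
  have *: "card {x. T x = l} = card {x. T x = 0}" if "l \<in> K" for l
    using surj[OF that] card_additive_fibre[of T, OF add] by blast
  have "CARD('a) = (\<Sum>l\<in>K. card {x\<in>UNIV. T x = l})"
    by (rule card_eq_sum_fibres) (use T_K in auto)
  also have "\<dots> = (\<Sum>l\<in>K. card {x. T x = 0})"
    by (rule sum.cong[OF refl]) (simp only: UNIV_I simp_thms *)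
  finally have "q * q = q * card {x. T x = 0}" by (simp add: card_K card_field power2_eq_square)
  then show ?thesis using q_ge_2 *[OF k] by simp
qed

text \<open>With \<open>g\<^sup>2 = \<gamma>\<close> the left side of the decoupled equation is
  \<open>(tr (g x))\<^sup>2 + tr (\<delta> x)\<close>. If \<open>tr (\<delta> x)\<close> is not a
  \<open>K\<close>-multiple of \<open>tr (g x)\<close>, all values in \<open>K\<close> are equally
  frequent. Otherwise the left side is \<open>s\<^sup>2 + t s\<close> with
  \<open>s = tr (g x)\<close>, and the deviation from \<open>q\<^sup>3\<close> is
  \<open>\<epsilon> q\<^sup>2 (r - 1)\<close>, where \<open>r \<le> 2\<close> counts the roots of
  \<open>s\<^sup>2 + t s + \<kappa>\<close> in \<open>K\<close>.\<close>

lemma card_affine_parabolic: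
  assumes c: "nm c = 1" and \<gamma>0: "a \<noteq> cj b * c\<^sup>2"
  shows "int (card (affine_points a b c d e f)) \<in>
    {int q ^ 3, int q ^ 3 - int q ^ 2, int q ^ 3 + int q ^ 2}"
proof -
  define \<gamma> \<delta> where "\<gamma> = a + cj b * c\<^sup>2" and "\<delta> = d + cj e * c"
  define T where "T x = tr (\<gamma> * x\<^sup>2 + \<delta> * x)" for x
  define G where "G = gform (cj b)"
  obtain \<kappa> where \<kappa>: "\<kappa> \<in> K" and card: "card (affine_points a b c d e f) =
      (\<Sum>X\<in>UNIV. card {x. T x = G X + \<kappa>})"
    unfolding T_def \<gamma>_def \<delta>_def G_def by (rule card_affine_decoupled[OF c])
  have GK: "G X + \<kappa> \<in> K" for X using \<kappa> by (simp add: G_def)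
  obtain g where g: "g\<^sup>2 = \<gamma>" using sqrt_ex by blast
  have "\<gamma> \<noteq> 0" using \<gamma>0 by (simp add: \<gamma>_def add_eq_0_iff_eq)
  then have g0: "g \<noteq> 0" using g by auto
  have T_eq: "T x = (tr (g * x))\<^sup>2 + tr (\<delta> * x)" for x
    by (simp add: T_def g[symmetric] tr_def char2)
  show ?thesis
  proof (cases "\<exists>x0. tr (g * x0) = 0 \<and> tr (\<delta> * x0) \<noteq> 0")
    case True
    then obtain x0 where x0: "tr (g * x0) = 0" "tr (\<delta> * x0) \<noteq> 0" by auto
    have "card {x. T x = k} = q" if "k \<in> K" for k
    proof (rule card_fibre_of_surj[OF _ _ _ that])
      show "T (x + y) = T x + T y" for x y by (simp add: T_def tr_def char2)
      show "T x \<in> K" for x by (simp add: T_def)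
      fix l assume l: "l \<in> K"
      \<comment> \<open>On \<open>K\<close>-multiples of \<open>x0\<close> the square term vanishes
        and \<open>T\<close> is linear, so a suitable multiple reaches \<open>l\<close>.\<close>
      define s where "s = l / tr (\<delta> * x0)"
      have "s \<in> K" using l by (simp add: s_def)
      then have "tr (r * (s * x0)) = s * tr (r * x0)" for r
        using tr_K_mult[of s "r * x0"] by (simp add: mult.left_commute)
      then have "T (s * x0) = s * tr (\<delta> * x0)"
        unfolding T_eq using x0(1) by simp
      then show "\<exists>x. T x = l" using x0(2) by (auto simp: s_def)
    qed
    then show ?thesis using card GK by (simp add: card_field power2_eq_square power3_eq_cube)
  next
    case False
    obtain x1 where x1: "tr x1 = 1" using tr_surj[of 1] by auto
    define t where "t = tr (\<delta> * (x1 / g))"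
    have t: "tr (\<delta> * x) = t * tr (g * x)" for x
    proof -
      define s where "s = tr (g * x)"
      have s: "s \<in> K" by (simp add: s_def)
      \<comment> \<open>Since \<open>x1\<close> has trace 1, adding \<open>s * (x1 / g)\<close>
        moves \<open>x\<close> into the kernel of the form given by \<open>g\<close>, where the form
        given by \<open>\<delta>\<close> vanishes too.\<close>
      have "tr (g * (x + s * (x1 / g))) = tr (g * x + s * x1)" using g0 by (simp add: distrib_left)
      also have "\<dots> = 0" using tr_K_mult[OF s] x1 by (simp add: tr_add s_def)
      finally have "tr (\<delta> * (x + s * (x1 / g))) = 0" using False by blast
      then have "tr (\<delta> * x) + s * t = 0"
        using tr_K_mult[OF s, of "\<delta> * (x1 / g)"] by (simp add: t_def distrib_left tr_add mult.left_commute)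
      then show ?thesis by (simp add: add_eq_0_iff_eq s_def mult.commute)
    qed
    have tK: "t \<in> K" by (simp add: t_def)
    have fib: "card {x. T x = k} = q * card {s\<in>K. s\<^sup>2 + t * s = k}" for k
    proof -
      have "card {x. T x = k} = (\<Sum>s\<in>K. card {x\<in>{x. T x = k}. tr (g * x) = s})"
        by (rule card_eq_sum_fibres) auto
      also have "\<dots> = (\<Sum>s\<in>K. if s\<^sup>2 + t * s = k then q else 0)"
      proof (rule sum.cong)
        fix s assume "s \<in> K"
        have "{x\<in>{x. T x = k}. tr (g * x) = s} = (if s\<^sup>2 + t * s = k then {x. tr (g * x) = s} else {})"
          by (auto simp: T_eq t)
        then show "card {x\<in>{x. T x = k}. tr (g * x) = s} = (if s\<^sup>2 + t * s = k then q else 0)"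
          by (simp only: card_tr_mult_fibre[OF \<open>s \<in> K\<close> g0] card.empty if_distrib[of card])
      qed simp
      finally show ?thesis by (simp add: sum.If_cases Int_def)
    qed
    obtain \<epsilon> where \<epsilon>: "\<epsilon> = 1 \<or> \<epsilon> = -1"
      "\<And>k. k \<in> K \<Longrightarrow> int (card {X. G X = k}) = int q - \<epsilon> + (if k = 0 then \<epsilon> * int q else 0)"
      unfolding G_def by (rule gform_distribution) blast
    define r where "r = card {s\<in>K. 1 * s\<^sup>2 + t * s + \<kappa> = 0}"
    have "r \<le> card {s. 1 * s\<^sup>2 + t * s + \<kappa> = 0}" unfolding r_def by (rule card_mono) auto
    then have "r \<le> 2" using card_quadratic_le[of 1 t \<kappa>] by simp
    have "(\<Sum>X\<in>UNIV. card {s\<in>K. s\<^sup>2 + t * s = G X + \<kappa>}) = card {(s, X). s \<in> K \<and> s\<^sup>2 + t * s = G X + \<kappa>}"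
      by (rule card_pairs[symmetric])
    also have "\<dots> = (\<Sum>s\<in>K. card {p \<in> {(s, X). s \<in> K \<and> s\<^sup>2 + t * s = G X + \<kappa>}. fst p = s})"
      by (rule card_eq_sum_fibres) auto
    also have "\<dots> = (\<Sum>s\<in>K. card {X. G X = s\<^sup>2 + t * s + \<kappa>})"
    proof (rule sum.cong)
      fix s assume "s \<in> K"
      have "s\<^sup>2 + t * s = G X + \<kappa> \<longleftrightarrow> G X = s\<^sup>2 + t * s + \<kappa>" for X by (metis add_eq_iff)
      then have "{p \<in> {(s, X). s \<in> K \<and> s\<^sup>2 + t * s = G X + \<kappa>}. fst p = s} =
          Pair s ` {X. G X = s\<^sup>2 + t * s + \<kappa>}" using \<open>s \<in> K\<close> by auto
      then show "card {p \<in> {(s, X). s \<in> K \<and> s\<^sup>2 + t * s = G X + \<kappa>}. fst p = s} =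
          card {X. G X = s\<^sup>2 + t * s + \<kappa>}" by (simp add: card_image inj_on_def)
    qed simp
    finally have "int (\<Sum>X\<in>UNIV. card {s\<in>K. s\<^sup>2 + t * s = G X + \<kappa>}) =
        (\<Sum>s\<in>K. int (card {X. G X = s\<^sup>2 + t * s + \<kappa>}))" by simp
    also have "\<dots> = (\<Sum>s\<in>K. int q - \<epsilon> + (if s\<^sup>2 + t * s + \<kappa> = 0 then \<epsilon> * int q else 0))"
    proof (rule sum.cong)
      fix s assume "s \<in> K"
      then have "s\<^sup>2 + t * s + \<kappa> \<in> K" using tK \<kappa> by (simp add: power2_eq_square)
      then show "int (card {X. G X = s\<^sup>2 + t * s + \<kappa>}) =
          int q - \<epsilon> + (if s\<^sup>2 + t * s + \<kappa> = 0 then \<epsilon> * int q else 0)" by (rule \<epsilon>(2))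
    qed simp
    also have "\<dots> = int q * (int q - \<epsilon>) + \<epsilon> * int q * int r"
      by (simp add: sum.distrib sum.If_cases Int_def card_K r_def)
    finally have "int (card (affine_points a b c d e f)) =
        int q * (int q * (int q - \<epsilon>) + \<epsilon> * int q * int r)"
      using card by (simp add: fib flip: sum_distrib_left)
    moreover have "r = 0 \<or> r = 1 \<or> r = 2" using \<open>r \<le> 2\<close> by auto
    ultimately show ?thesis
      using \<epsilon>(1) by (auto simp: algebra_simps power2_eq_square power3_eq_cube)
  qed
qed

text \<open>The decoupled equation has no \<open>x\<^sup>2\<close> term here. A non-zero
  \<open>X\<close> with \<open>G X = 0\<close> would give the root \<open>c * cj X / X\<close> of
  norm 1, so \<open>G\<close> is anisotropic and \<open>\<epsilon> = -1\<close>. If also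
  \<open>\<delta> = 0\<close>, then \<open>x\<close> is free and each \<open>X\<close> with
  \<open>G X = \<kappa>\<close> yields \<open>q\<^sup>2\<close> points; \<open>\<kappa> = 0\<close>
  is the source of the size \<open>q\<^sup>2 + 1\<close>.\<close>

lemma card_affine_anisotropic_radical:
  assumes c: "nm c = 1" and a: "a = cj b * c\<^sup>2"
    and no_root: "\<And>t. nm t = 1 \<Longrightarrow> a + c * t + b * t\<^sup>2 \<noteq> 0"
  shows "int (card (affine_points a b c d e f)) \<in> {int q ^ 3, int q ^ 2, int q ^ 3 + int q ^ 2}"
proof -
  define \<delta> where "\<delta> = d + cj e * c"
  define G where "G = gform (cj b)"
  obtain \<kappa> where \<kappa>: "\<kappa> \<in> K" and card: "card (affine_points a b c d e f) =
      (\<Sum>X\<in>UNIV. card {x. tr (\<delta> * x) = G X + \<kappa>})"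
    unfolding \<delta>_def G_def by (rule card_affine_decoupled[OF c, of a b d e f]) (simp add: a)
  have GK: "G X + \<kappa> \<in> K" for X using \<kappa> by (simp add: G_def)
  have G_zero: "{X. G X = 0} = {0}"
  proof -
    have "X = 0" if "G X = 0" for X
    proof (rule ccontr)
      assume X: "X \<noteq> 0"
      have "c \<noteq> 0" using c by (auto simp: nm_def)
      define u where "u = cj X / X"
      have "X\<^sup>2 * (cj b + u + b * u\<^sup>2) = G X"
        using X by (simp add: u_def G_def gform_def nm_def tr_def field_simps power2_eq_square)
      then have "cj b + u + b * u\<^sup>2 = 0" using that X by simp
      then have "c\<^sup>2 * (cj b + u + b * u\<^sup>2) = 0" by simp
      then have "a + c * (c * u) + b * (c * u)\<^sup>2 = 0"
        by (simp add: a algebra_simps power2_eq_square)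
      moreover have "nm (c * u) = 1" using X c by (simp add: u_def nm_mult nm_divide)
      ultimately show False using no_root by blast
    qed
    moreover have "G 0 = 0" by (simp add: G_def gform_def)
    ultimately show ?thesis by auto
  qed
  show ?thesis
  proof (cases "\<delta> = 0")
    case False
    then show ?thesis
      using card card_tr_mult_fibre[OF GK] by (simp add: card_field power2_eq_square power3_eq_cube)
  next
    case True
    obtain \<epsilon> where \<epsilon>: "\<epsilon> = 1 \<or> \<epsilon> = -1"
      "\<And>k. k \<in> K \<Longrightarrow> int (card {X. G X = k}) = int q - \<epsilon> + (if k = 0 then \<epsilon> * int q else 0)"
      unfolding G_def by (rule gform_distribution) blast
    have "\<epsilon> = -1" using \<epsilon>(2)[of 0] \<epsilon>(1) q_ge_2 by (auto simp: G_zero)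
    have eq: "0 = G X + \<kappa> \<longleftrightarrow> G X = \<kappa>" for X by (metis add_eq_0_iff_eq)
    have "card (affine_points a b c d e f) = (\<Sum>X\<in>UNIV. if G X = \<kappa> then q\<^sup>2 else 0)"
      unfolding card True by (intro sum.cong) (auto simp: eq card_field)
    also have "\<dots> = q\<^sup>2 * card {X. G X = \<kappa>}" by (simp add: sum.If_cases)
    finally have "int (card (affine_points a b c d e f)) = (int q)\<^sup>2 * int (card {X. G X = \<kappa>})" by simp
    also have "int (card {X. G X = \<kappa>}) = (if \<kappa> = 0 then 1 else int q + 1)"
      using \<epsilon>(2)[OF \<kappa>] \<open>\<epsilon> = -1\<close> by simp
    finally show ?thesis by (auto simp: algebra_simps power2_eq_square power3_eq_cube)
  qed
qed

text \<open>Elements of \<open>K\<close> become of the form \<open>s\<^sup>2 + s\<close> over the quadratic extension of \<open>K\<close>: the map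
  \<open>s \<mapsto> s\<^sup>2 + s\<close> sends the \<open>2 q\<close> elements with trace 0 or 1 at most two-to-one into \<open>K\<close>.\<close>

lemma artin_schreier_K:
  assumes u: "u \<in> K"
  shows "\<exists>s. s\<^sup>2 + s = u"
proof (rule ccontr)
  assume none: "\<not> ?thesis"
  define A where "A = {s. tr s = 0} \<union> {s. tr s = 1}"
  have "card A = q + q"
    unfolding A_def by (subst card_Un_disjoint) (auto simp: card_tr_fibre)
  have "card A = (\<Sum>k\<in>K. card {s\<in>A. s\<^sup>2 + s = k})"
  proof (rule card_eq_sum_fibres)
    have eq: "cj (s\<^sup>2 + s) + (s\<^sup>2 + s) = (tr s)\<^sup>2 + tr s" for s
      by (simp add: tr_def char2)
    have "cj (s\<^sup>2 + s) + (s\<^sup>2 + s) = 0" if "s \<in> A" for s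
      unfolding eq using that by (auto simp: A_def)
    then have "cj (s\<^sup>2 + s) = s\<^sup>2 + s" if "s \<in> A" for s
      using that by (simp only: add_eq_0_iff_eq)
    then show "(\<lambda>s. s\<^sup>2 + s) ` A \<subseteq> K" by (auto simp: K_def)
  qed auto
  \<comment> \<open>An empty fibre over \<open>u\<close> leaves room for only
    \<open>2 (q - 1)\<close> of the \<open>2 q\<close> elements.\<close>
  also have "\<dots> = (\<Sum>k\<in>K - {u}. card {s\<in>A. s\<^sup>2 + s = k})"
    using none by (subst sum.remove[of K u]) (auto simp: u)
  also have "\<dots> \<le> (\<Sum>k\<in>K - {u}. 2)"
  proof (rule sum_mono)
    fix k
    have "card {s\<in>A. s\<^sup>2 + s = k} \<le> card {s. 1 * s\<^sup>2 + 1 * s + k = 0}"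
      by (rule card_mono) (auto simp: add_eq_0_iff_eq)
    then show "card {s\<in>A. s\<^sup>2 + s = k} \<le> 2" using card_quadratic_le[of 1 1 k] by simp
  qed
  also have "\<dots> = 2 * (q - 1)" by (simp add: card_Diff_subset card_K u)
  finally show False using \<open>card A = q + q\<close> q_ge_2 by simp
qed

text \<open>For \<open>b \<noteq> 0\<close>, putting \<open>y = (c s / b) x\<close> turns the form
  into a multiple of \<open>s\<^sup>2 + s + nm b\<close>, which has a root because
  \<open>nm b\<close> lies in \<open>K\<close>. In the elliptic case this excludes
  \<open>a = cj b * c\<^sup>2\<close>.\<close>

lemma isotropic_of_radical:
  assumes c: "nm c = 1" and a: "a = cj b * c\<^sup>2"
  shows "\<exists>x y. (x \<noteq> 0 \<or> y \<noteq> 0) \<and> a * x\<^sup>2 + b * y\<^sup>2 + c * x * y = 0"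
proof (cases "b = 0")
  case True
  then show ?thesis using a by (intro exI[of _ 1] exI[of _ 0]) simp
next
  case False
  obtain s where s: "s\<^sup>2 + s = nm b" using artin_schreier_K by force
  have "b * (a + b * (c * s / b)\<^sup>2 + c * (c * s / b)) = a * b + c\<^sup>2 * (s\<^sup>2 + s)"
    using False by (simp add: field_simps power2_eq_square)
  also have "\<dots> = 0" unfolding s a by (simp add: nm_def mult_ac)
  finally have "a * 1\<^sup>2 + b * (c * s / b)\<^sup>2 + c * 1 * (c * s / b) = 0" using False by simp
  then show ?thesis by (intro exI[of _ 1] exI[of _ "c * s / b"]) simp
qed

end

subsection \<open>Adapted coordinates and the types of quadrics\<close>

lemma polar_quad_form:
  "polar_form (quad_form A) x y = (\<Sum>i\<in>UNIV. \<Sum>j\<in>UNIV. A $ i $ j * (x $ i * y $ j + y $ i * x $ j))"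
  unfolding polar_form_def quad_form_def
  by (simp add: algebra_simps flip: sum.distrib sum_subtractf)

lemma polar_form_sym: "polar_form Q x y = polar_form Q y x"
  by (simp add: polar_form_def add.commute)

lemma polar_quad_form_add_left:
  "polar_form (quad_form A) (x + y) w = polar_form (quad_form A) x w + polar_form (quad_form A) y w"
  unfolding polar_quad_form by (simp add: algebra_simps flip: sum.distrib)

lemma polar_quad_form_scale_left:
  "polar_form (quad_form A) (k *s x) w = k * polar_form (quad_form A) x w"
  unfolding polar_quad_form by (simp add: sum_distrib_left algebra_simps)

lemma polar_quad_form_add_right:
  "polar_form (quad_form A) w (x + y) = polar_form (quad_form A) w x + polar_form (quad_form A) w y"
  by (metis polar_form_sym polar_quad_form_add_left)

lemma polar_quad_form_scale_right:
  "polar_form (quad_form A) w (k *s x) = k * polar_form (quad_form A) w x"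
  by (metis polar_form_sym polar_quad_form_scale_left)

lemmas polar_linear = polar_quad_form_add_left polar_quad_form_add_right
  polar_quad_form_scale_left polar_quad_form_scale_right

lemma quad_form_scale: "quad_form A (k *s x) = k\<^sup>2 * quad_form A x"
  unfolding quad_form_def by (simp add: sum_distrib_left algebra_simps power2_eq_square)

lemma quad_form_add: "quad_form A (x + y) = quad_form A x + quad_form A y + polar_form (quad_form A) x y"
  by (simp add: polar_form_def)

context even_square_field
begin

section \<open>The sesquilinear form of the Hermitian surface and an adapted frame\<close>

lemma hermf_eq:
  fixes H :: "'a ^ 4 ^ 4"
  shows "herm_tangent_form q H x y = (\<Sum>i\<in>UNIV. \<Sum>j\<in>UNIV. cj (x $ i) * H $ i $ j * y $ j)"
  by (simp add: herm_tangent_form_def cj_def)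

lemma herm_form_eq: "herm_form q H x = herm_tangent_form q H x x"
  by (simp add: herm_form_def herm_tangent_form_def)

lemma hermf_add_left:
  fixes H :: "'a ^ 4 ^ 4"
  shows "herm_tangent_form q H (x + y) w = herm_tangent_form q H x w + herm_tangent_form q H y w"
  unfolding hermf_eq by (simp add: algebra_simps flip: sum.distrib)

lemma hermf_add_right:
  fixes H :: "'a ^ 4 ^ 4"
  shows "herm_tangent_form q H w (x + y) = herm_tangent_form q H w x + herm_tangent_form q H w y"
  unfolding hermf_eq by (simp add: algebra_simps flip: sum.distrib)

lemma hermf_scale_left:
  fixes H :: "'a ^ 4 ^ 4"
  shows "herm_tangent_form q H (k *s x) w = cj k * herm_tangent_form q H x w"
  unfolding hermf_eq by (simp add: sum_distrib_left algebra_simps)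

lemma hermf_scale_right:
  fixes H :: "'a ^ 4 ^ 4"
  shows "herm_tangent_form q H w (k *s x) = k * herm_tangent_form q H w x"
  unfolding hermf_eq by (simp add: sum_distrib_left algebra_simps)

lemmas hermf_linear = hermf_add_left hermf_add_right hermf_scale_left hermf_scale_right

lemma cj_sum: "cj (sum f S) = (\<Sum>i\<in>S. cj (f i))"
  by (induction S rule: infinite_finite_induct) auto

lemma hermf_sym:
  fixes H :: "'a ^ 4 ^ 4"
  assumes "hermitian_matrix q H"
  shows "herm_tangent_form q H y x = cj (herm_tangent_form q H x y)"
proof -
  have "cj (H $ i $ j) = H $ j $ i" for i j
    using assms unfolding hermitian_matrix_def cj_def by metis
  then have "cj (herm_tangent_form q H x y) = (\<Sum>i\<in>UNIV. \<Sum>j\<in>UNIV. cj (y $ j) * H $ j $ i * x $ i)"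
    by (simp add: hermf_eq cj_sum ac_simps)
  also have "\<dots> = herm_tangent_form q H y x"
    unfolding hermf_eq by (rule sum.swap)
  finally show ?thesis by simp
qed

lemma hermf_nondegenerate:
  fixes H :: "'a ^ 4 ^ 4"
  assumes "nondeg_hermitian q H" "u \<noteq> 0"
  shows "\<exists>w. herm_tangent_form q H u w \<noteq> 0"
proof (rule ccontr)
  assume none: "\<not> ?thesis"
  define v :: "'a ^ 4" where "v = (\<chi> i. cj (u $ i))"
  have "det (transpose H) \<noteq> 0" using assms by (simp add: nondeg_hermitian_def det_transpose)
  then have "invertible (transpose H)" by (simp add: invertible_det_nz)
  moreover have "transpose H *v v = 0"
    unfolding vec_eq_iff
  proof
    fix j
    have "herm_tangent_form q H u (axis j 1) = (\<Sum>i\<in>UNIV. cj (u $ i) * H $ i $ j)"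
      unfolding hermf_eq by (intro sum.cong) (simp_all add: axis_def if_distrib cong: if_cong)
    then show "(transpose H *v v) $ j = 0 $ j"
      using none by (simp add: matrix_vector_mult_def transpose_def v_def mult.commute)
  qed
  ultimately have "v = 0"
    unfolding invertible_left_inverse using matrix_left_invertible_ker by blast
  then show False using assms(2) by (simp add: v_def vec_eq_iff)
qed

text \<open>\<open>C\<close> stands for the orthogonal complement of the vectors chosen so far;
  \<open>proj\<close> transfers non-degeneracy to it without a dimension argument.\<close>

lemma hermitian_unit_vector:
  fixes H :: "'a ^ 4 ^ 4"
  assumes H: "nondeg_hermitian q H"
    and closed: "\<And>k x y. x \<in> C \<Longrightarrow> y \<in> C \<Longrightarrow> x + k *s y \<in> C" and C0: "0 \<in> C"
    and proj: "\<And>u w. u \<in> C \<Longrightarrow> \<exists>w'\<in>C. herm_tangent_form q H u w' = herm_tangent_form q H u w"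
    and u: "u \<in> C" "u \<noteq> 0"
  obtains e where "e \<in> C" "herm_tangent_form q H e e = 1"
proof -
  let ?h = "herm_tangent_form q H"
  have herm: "hermitian_matrix q H" using H by (simp add: nondeg_hermitian_def)
  have sym: "?h y x = cj (?h x y)" for x y by (rule hermf_sym[OF herm])
  obtain w where w: "w \<in> C" "?h u w \<noteq> 0"
    using hermf_nondegenerate[OF H u(2)] proj[OF u(1)] by metis
  have "\<exists>v\<in>C. ?h v v \<noteq> 0"
  proof (rule ccontr)
    assume none: "\<not> ?thesis"
    obtain x where x: "tr x = 1" using tr_surj[of 1] by auto
    \<comment> \<open>Chosen so that \<open>tr (k * ?h u w) = 1\<close>; if all of \<open>C\<close>
      were isotropic, this would be the value of the form at \<open>u + k w\<close>.\<close>
    define k where "k = x / ?h u w"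
    have "?h (u + k *s w) (u + k *s w) = ?h u u + nm k * ?h w w + tr (k * ?h u w)"
      by (simp add: hermf_linear sym[of u w] tr_def nm_def algebra_simps)
    moreover have "u + k *s w \<in> C" using closed u w by blast
    ultimately show False using none u(1) w by (auto simp: k_def x)
  qed
  then obtain v where v: "v \<in> C" "?h v v \<noteq> 0" by auto
  have "?h v v \<in> K" using sym[of v v] by (simp add: K_def)
  then obtain s where s: "s \<in> K" "s\<^sup>2 = ?h v v" by (rule sqrt_K)
  have "s \<noteq> 0" using s v by auto
  have "?h (inverse s *s v) (inverse s *s v) = inverse s * inverse s * s\<^sup>2"
    using s by (simp add: hermf_linear cj_inverse K_def)
  also have "\<dots> = 1" using \<open>s \<noteq> 0\<close> by (simp add: field_simps power2_eq_square)
  finally show ?thesis using that closed[OF C0 v(1), of "inverse s"] by simp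
qed

definition frame :: "'a ^ 4 \<Rightarrow> 'a ^ 4 \<Rightarrow> 'a ^ 4 \<Rightarrow> 'a ^ 4 \<Rightarrow> 'a \<times> 'a \<times> 'a \<times> 'a \<Rightarrow> 'a ^ 4" where
  "frame e0 e1 e2 P = (\<lambda>(J, x, y, z). J *s e0 + x *s e1 + y *s e2 + z *s P)"

text \<open>\<open>P\<close> is completed to a hyperbolic pair with \<open>e0\<close>, and two
  orthonormal vectors are taken in its complement. Pairing with \<open>P\<close>, \<open>e1\<close>,
  \<open>e2\<close>, \<open>e0\<close> recovers the coordinates, which gives injectivity;
  cardinalities give the rest.\<close>

lemma hermitian_frame:
  fixes H :: "'a ^ 4 ^ 4" and P :: "'a ^ 4"
  assumes H: "nondeg_hermitian q H" and P: "P \<noteq> 0" "herm_form q H P = 0"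
  obtains e0 e1 e2 where "bij (frame e0 e1 e2 P)"
    "\<And>J x y z. herm_tangent_form q H P (frame e0 e1 e2 P (J, x, y, z)) = J"
    "\<And>J x y z. herm_form q H (frame e0 e1 e2 P (J, x, y, z)) = tr (cj J * z) + nm x + nm y"
proof -
  let ?h = "herm_tangent_form q H"
  have herm: "hermitian_matrix q H" using H by (simp add: nondeg_hermitian_def)
  have sym: "?h y x = cj (?h x y)" for x y by (rule hermf_sym[OF herm])
  have sym0: "?h y x = 0" if "?h x y = 0" for x y using sym[of y x] that by simp
  have PP: "?h P P = 0" using P(2) by (simp add: herm_form_eq)
  obtain w where w: "?h P w \<noteq> 0" using hermf_nondegenerate[OF H P(1)] by blast
  define w1 where "w1 = inverse (?h P w) *s w"
  have Pw1: "?h P w1 = 1" using w by (simp add: w1_def hermf_linear)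
  have "?h w1 w1 \<in> K" using sym[of w1 w1] by (simp add: K_def)
  \<comment> \<open>Adding \<open>k P\<close> to \<open>w1\<close> changes the value of the form by
    \<open>tr k\<close>, so this \<open>k\<close> makes \<open>e0\<close> isotropic.\<close>
  then obtain k where k: "tr k = ?h w1 w1" using tr_surj by blast
  define e0 where "e0 = w1 + k *s P"
  have Pe0: "?h P e0 = 1" by (simp add: e0_def hermf_linear Pw1 PP)
  then have e0P: "?h e0 P = 1" using sym[of e0 P] by simp
  have "?h e0 e0 = ?h w1 w1 + tr k"
    using sym[of w1 P] by (simp add: e0_def hermf_linear Pw1 PP tr_def ac_simps)
  then have e00: "?h e0 e0 = 0" using k by simp
  define C1 where "C1 = {u. ?h P u = 0 \<and> ?h e0 u = 0}"
  \<comment> \<open>Orthogonal projection onto the complement of \<open>P\<close> and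
    \<open>e0\<close>, with plus for minus in characteristic 2.\<close>
  define p1 where "p1 v = v + (?h e0 v *s P + ?h P v *s e0)" for v
  have vec_add_self: "(v::'a^4) + v = 0" for v by (simp add: vec_eq_iff)
  have p1: "p1 v \<in> C1" for v
    by (simp add: C1_def p1_def hermf_linear PP Pe0 e0P e00)
  define f1 where "f1 = (\<lambda>(a, b). a *s P + b *s e0)"
  \<comment> \<open>There are \<open>q ^ 8\<close> vectors but at most \<open>q ^ 4\<close>
    combinations; a vector outside the span has a non-zero projection.\<close>
  have "\<exists>v. v \<notin> range f1"
  proof (rule ccontr)
    assume "\<not> ?thesis"
    then have "range f1 = UNIV" by auto
    then have "CARD('a ^ 4) \<le> CARD('a \<times> 'a)" by (metis card_image_le finite)
    then have "(q\<^sup>2) ^ 4 \<le> (q\<^sup>2) ^ 2" by (simp add: card_field power2_eq_square)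
    then show False using q_ge_2 by (simp flip: power_mult)
  qed
  then obtain v where v: "v \<notin> range f1" by blast
  then have "v \<noteq> f1 (a, b)" for a b by blast
  then have v_span: "v \<noteq> a *s P + b *s e0" for a b by (simp add: f1_def)
  have "p1 v \<noteq> 0"
  proof
    assume "p1 v = 0"
    then have "v = ?h e0 v *s P + ?h P v *s e0"
      unfolding p1_def by (simp add: vec_eq_iff add_eq_0_iff_eq)
    then show False using v_span by blast
  qed
  obtain e1 where e1: "e1 \<in> C1" "?h e1 e1 = 1"
  proof (rule hermitian_unit_vector[OF H, of C1 "p1 v"])
    show "x + k *s y \<in> C1" if "x \<in> C1" "y \<in> C1" for k x y
      using that by (simp add: C1_def hermf_linear)
    show "0 \<in> C1" by (simp add: C1_def hermf_eq)
    show "\<exists>w'\<in>C1. ?h u w' = ?h u w" if "u \<in> C1" for u w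
      using that p1[of w] sym0 by (intro bexI[of _ "p1 w"]) (auto simp: p1_def C1_def hermf_linear)
  qed (use p1 \<open>p1 v \<noteq> 0\<close> in auto)
  define C2 where "C2 = {u. ?h P u = 0 \<and> ?h e0 u = 0 \<and> ?h e1 u = 0}"
  define p2 where "p2 v = v + (?h e0 v *s P + ?h P v *s e0 + ?h e1 v *s e1)" for v
  have e1': "?h P e1 = 0" "?h e0 e1 = 0" "?h e1 P = 0" "?h e1 e0 = 0"
    using e1 sym0 by (auto simp: C1_def)
  have p2: "p2 v \<in> C2" for v
    by (simp add: C2_def p2_def hermf_linear PP Pe0 e0P e00 e1' e1)
  define f2 where "f2 = (\<lambda>(a, b, c). a *s P + b *s e0 + c *s e1)"
  have "\<exists>v. v \<notin> range f2"
  proof (rule ccontr)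
    assume "\<not> ?thesis"
    then have "range f2 = UNIV" by auto
    then have "CARD('a ^ 4) \<le> CARD('a \<times> 'a \<times> 'a)" by (metis card_image_le finite)
    then have "(q\<^sup>2) ^ 4 \<le> (q\<^sup>2) ^ 3" by (simp add: card_field power3_eq_cube)
    then show False using q_ge_2 by (simp flip: power_mult)
  qed
  then obtain v' where v': "v' \<notin> range f2" by blast
  then have "v' \<noteq> f2 (a, b, c)" for a b c by blast
  then have v'_span: "v' \<noteq> a *s P + b *s e0 + c *s e1" for a b c by (simp add: f2_def)
  have "p2 v' \<noteq> 0"
  proof
    assume "p2 v' = 0"
    then have "v' = ?h e0 v' *s P + ?h P v' *s e0 + ?h e1 v' *s e1"
      unfolding p2_def by (simp add: vec_eq_iff add_eq_0_iff_eq)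
    then show False using v'_span by blast
  qed
  obtain e2 where e2: "e2 \<in> C2" "?h e2 e2 = 1"
  proof (rule hermitian_unit_vector[OF H, of C2 "p2 v'"])
    show "x + k *s y \<in> C2" if "x \<in> C2" "y \<in> C2" for k x y
      using that by (simp add: C2_def hermf_linear)
    show "0 \<in> C2" by (simp add: C2_def hermf_eq)
    show "\<exists>w'\<in>C2. ?h u w' = ?h u w" if "u \<in> C2" for u w
      using that p2[of w] sym0 by (intro bexI[of _ "p2 w"]) (auto simp: p2_def C2_def hermf_linear)
  qed (use p2 \<open>p2 v' \<noteq> 0\<close> in auto)
  have e2': "?h P e2 = 0" "?h e0 e2 = 0" "?h e1 e2 = 0" "?h e2 P = 0" "?h e2 e0 = 0" "?h e2 e1 = 0"
    using e2 sym0 by (auto simp: C2_def)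
  let ?F = "frame e0 e1 e2 P"
  have hP: "?h P (?F (J, x, y, z)) = J" and h1: "?h e1 (?F (J, x, y, z)) = x"
    and h2: "?h e2 (?F (J, x, y, z)) = y" and h0: "?h e0 (?F (J, x, y, z)) = z" for J x y z
    by (simp_all add: frame_def hermf_linear PP Pe0 e0P e00 e1' e1 e2' e2)
  have "inj ?F"
  proof (rule injI)
    fix p p' assume eq: "?F p = ?F p'"
    obtain J x y z J' x' y' z' where p: "p = (J, x, y, z)" "p' = (J', x', y', z')"
      by (metis prod_cases4)
    then show "p = p'" using eq hP h1 h2 h0 by metis
  qed
  moreover have "CARD('a \<times> 'a \<times> 'a \<times> 'a) = CARD('a ^ 4)"
    by (simp add: power4_eq_xxxx)
  ultimately have "bij ?F" by (metis bij_betw_def card_image card_subset_eq finite subset_UNIV)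
  moreover have "herm_form q H (?F (J, x, y, z)) = tr (cj J * z) + nm x + nm y" for J x y z
  proof -
    let ?v = "?F (J, x, y, z)"
    have "?h ?v v = cj J * ?h e0 v + cj x * ?h e1 v + cj y * ?h e2 v + cj z * ?h P v" for v
      by (simp add: frame_def hermf_linear)
    then show ?thesis
      by (simp add: herm_form_eq hP h0 h1 h2 tr_def nm_def ac_simps)
  qed
  ultimately show ?thesis using that hP by blast
qed

text \<open>No term in \<open>z\<^sup>2\<close>, \<open>x z\<close> or \<open>y z\<close> survives,
  because \<open>P\<close> is on the quadric and \<open>e1\<close>, \<open>e2\<close> are in its
  tangent plane.\<close>

lemma quad_form_frame:
  fixes A :: "'a ^ 4 ^ 4"
  assumes "quad_form A P = 0" "polar_form (quad_form A) P e1 = 0" "polar_form (quad_form A) P e2 = 0"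
  shows "quad_form A (frame e0 e1 e2 P (J, x, y, z)) =
    J * z * polar_form (quad_form A) P e0 + x\<^sup>2 * quad_form A e1 + y\<^sup>2 * quad_form A e2 +
    x * y * polar_form (quad_form A) e1 e2 + J * x * polar_form (quad_form A) e0 e1 +
    J * y * polar_form (quad_form A) e0 e2 + J\<^sup>2 * quad_form A e0"
  unfolding frame_def
  using assms polar_form_sym[of "quad_form A" e0 P] polar_form_sym[of "quad_form A" e1 P]
    polar_form_sym[of "quad_form A" e2 P]
  by (simp add: quad_form_add quad_form_scale polar_linear algebra_simps)

section \<open>Invariants that separate the three types of quadrics\<close>

lemma polar_proj_equiv:
  assumes "\<And>x. Q (M *v x) = k * C x"
  shows "polar_form Q (M *v x) (M *v y) = k * polar_form C x y"
  using assms by (simp add: polar_form_def algebra_simps flip: matrix_vector_right_distrib)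

lemma invertible_surjE:
  fixes M :: "'a ^ 4 ^ 4"
  assumes "invertible M"
  obtains x where "M *v x = y"
  using assms unfolding invertible_right_inverse
  by (metis matrix_vector_mul_assoc matrix_vector_mul_lid)

text \<open>The square in \<open>x1 x2 + x3\<^sup>2\<close> contributes nothing to the polar form,
  so the third basis vector, the nucleus of the conic, lies in the radical but off the cone.\<close>

lemma cone_radical:
  fixes Q :: "'a ^ 4 \<Rightarrow> 'a"
  assumes "is_quadratic_cone Q"
  obtains r where "Q r \<noteq> 0" "\<And>y. polar_form Q r y = 0"
proof -
  define C :: "'a ^ 4 \<Rightarrow> 'a" where "C x = x$1 * x$2 + (x$3)\<^sup>2" for x
  obtain M k where M: "invertible M" "k \<noteq> 0" "\<And>x. Q (M *v x) = k * C x"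
    using assms unfolding is_quadratic_cone_def proj_equiv_form_def C_def by blast
  define e3 :: "'a ^ 4" where "e3 = axis 3 1"
  have e3: "e3 $ 1 = 0" "e3 $ 2 = 0" "e3 $ 3 = 1" by (simp_all add: e3_def axis_def)
  have "polar_form Q (M *v e3) y = 0" for y
  proof -
    obtain x where "M *v x = y" using invertible_surjE[OF M(1)] .
    moreover have "polar_form C e3 x = 0" by (simp add: polar_form_def C_def e3 char2)
    ultimately show ?thesis using polar_proj_equiv[where Q = Q and M = M and k = k and C = C, OF M(3), of e3 x] by simp
  qed
  moreover have "Q (M *v e3) \<noteq> 0" using M by (simp add: C_def e3)
  ultimately show ?thesis using that by blast
qed

lemma hyperbolic_polar_nondegenerate:
  fixes Q :: "'a ^ 4 \<Rightarrow> 'a"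
  assumes "is_hyperbolic_quadric Q" "r \<noteq> 0"
  shows "\<exists>y. polar_form Q r y \<noteq> 0"
proof -
  define C :: "'a ^ 4 \<Rightarrow> 'a" where "C x = x$1 * x$2 + x$3 * x$4" for x
  obtain M k where M: "invertible M" "k \<noteq> 0" "\<And>x. Q (M *v x) = k * C x"
    using assms unfolding is_hyperbolic_quadric_def proj_equiv_form_def C_def by blast
  obtain x where x: "M *v x = r" using invertible_surjE[OF M(1)] .
  have C: "polar_form C x y = x$1 * y$2 + x$2 * y$1 + x$3 * y$4 + x$4 * y$3" for y
    by (simp add: polar_form_def C_def char2)
  have "x \<noteq> 0" using x assms(2) by auto
  then have "\<exists>y. polar_form C x y \<noteq> 0"
  proof -
    have "polar_form C x (axis 2 1) = x$1" "polar_form C x (axis 1 1) = x$2"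
      "polar_form C x (axis 4 1) = x$3" "polar_form C x (axis 3 1) = x$4"
      by (simp_all add: C axis_def)
    moreover have "x$1 \<noteq> 0 \<or> x$2 \<noteq> 0 \<or> x$3 \<noteq> 0 \<or> x$4 \<noteq> 0"
      using \<open>x \<noteq> 0\<close> by (auto simp: vec_eq_iff forall_4)
    ultimately show ?thesis by metis
  qed
  then show ?thesis using polar_proj_equiv[where Q = Q and M = M and k = k and C = C, OF M(3)] M(2) x by (metis mult_eq_0_iff)
qed

text \<open>Eliminating the first or the second coordinate on the span gives \<open>w\<close> and
  \<open>w'\<close>. Anisotropy in the last two coordinates puts \<open>w\<close> on the second axis
  and \<open>w'\<close> on the first, with equal entries, and \<open>C (w + w') = 0\<close> says
  that the square of this entry is 0.\<close>

lemma elliptic_no_line: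
  fixes Q :: "'a ^ 4 \<Rightarrow> 'a"
  assumes "is_elliptic_quadric Q" and line: "\<And>\<alpha> \<beta>. Q (\<alpha> *s u + \<beta> *s v) = 0"
  shows "\<exists>\<alpha> \<beta>. (\<alpha> \<noteq> 0 \<or> \<beta> \<noteq> 0) \<and> \<alpha> *s u + \<beta> *s v = 0"
proof (rule ccontr)
  assume indep: "\<not> ?thesis"
  obtain d where d: "\<And>t. t\<^sup>2 + t + d \<noteq> (0::'a)"
    and eqv: "proj_equiv_form Q (\<lambda>x. x$1 * x$2 + x$3^2 + x$3 * x$4 + d * x$4^2)"
    using assms(1) unfolding is_elliptic_quadric_def by blast
  define C :: "'a ^ 4 \<Rightarrow> 'a" where "C x = x$1 * x$2 + (x$3)\<^sup>2 + x$3 * x$4 + d * (x$4)\<^sup>2" for x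
  obtain M k where M: "invertible M" "k \<noteq> 0" "\<And>x. Q (M *v x) = k * C x"
    using eqv unfolding proj_equiv_form_def C_def by blast
  obtain x where x: "M *v x = u" using invertible_surjE[OF M(1)] .
  obtain y where y: "M *v y = v" using invertible_surjE[OF M(1)] .
  have lin: "M *v (\<alpha> *s x + \<beta> *s y) = \<alpha> *s u + \<beta> *s v" for \<alpha> \<beta>
    by (simp add: matrix_vector_right_distrib vector_scalar_commute x y)
  have C0: "C (\<alpha> *s x + \<beta> *s y) = 0" for \<alpha> \<beta>
    using M(2) M(3)[of "\<alpha> *s x + \<beta> *s y"] line by (simp add: lin)
  have indep': "\<alpha> = 0 \<and> \<beta> = 0" if "\<alpha> *s x + \<beta> *s y = 0" for \<alpha> \<beta>
    using indep lin[of \<alpha> \<beta>] that by auto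
  have aniso: "s = 0 \<and> t = 0" if "s\<^sup>2 + s * t + d * t\<^sup>2 = 0" for s t
  proof (cases "t = 0")
    case False
    have "t\<^sup>2 * ((s / t)\<^sup>2 + s / t + d) = s\<^sup>2 + s * t + d * t\<^sup>2"
      using False by (simp add: field_simps power2_eq_square)
    then show ?thesis using that d False by simp
  qed (use that in simp)
  have C34: "w $ 3 = 0 \<and> w $ 4 = 0" if "C w = 0" "w $ 1 = 0 \<or> w $ 2 = 0" for w
    using aniso[of "w$3" "w$4"] that by (auto simp: C_def add.assoc)
  define w where "w = (y$1) *s x + (x$1) *s y"
  define w' where "w' = (y$2) *s x + (x$2) *s y"
  have w: "w$1 = 0" "w$3 = 0 \<and> w$4 = 0"
    using C34[of w] C0 by (auto simp: w_def)
  have w': "w'$2 = 0" "w'$3 = 0 \<and> w'$4 = 0"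
    using C34[of w'] C0 by (auto simp: w'_def)
  have ww': "w'$1 = w$2" by (simp add: w_def w'_def mult.commute add.commute)
  have "w + w' = (y$1 + y$2) *s x + (x$1 + x$2) *s y"
    by (simp add: w_def w'_def vec_eq_iff algebra_simps)
  then have "C (w + w') = 0" by (simp only: C0)
  then have "w$2 = 0" using w w' ww' by (simp add: C_def)
  then have "w = 0" "w' = 0" using w w' ww' by (simp_all add: vec_eq_iff forall_4)
  \<comment> \<open>\<open>w = 0\<close> and \<open>w' = 0\<close> are linear relations between
    \<open>x\<close> and \<open>y\<close>, so their coefficients vanish.\<close>
  then have "x$1 = 0" "x$2 = 0" using indep' by (auto simp: w_def w'_def)
  moreover have "C x = 0" using C0[of 1 0] by simp
  ultimately have "x = 0" using C34[of x] by (simp add: vec_eq_iff forall_4)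
  then show False using indep'[of 1 0] by simp
qed


subsection \<open>Counting the common points\<close>

lemma card_proj_zero_points:
  fixes f g :: "'a ^ 4 \<Rightarrow> 'a"
  assumes f: "\<And>k v. k \<noteq> 0 \<Longrightarrow> f (k *s v) = 0 \<longleftrightarrow> f v = 0"
    and g: "\<And>k v. k \<noteq> 0 \<Longrightarrow> g (k *s v) = 0 \<longleftrightarrow> g v = 0"
  shows "card {v. v \<noteq> 0 \<and> f v = 0 \<and> g v = 0} =
    (q\<^sup>2 - 1) * card (pg3_zero_points f \<inter> pg3_zero_points g)"
proof -
  define Z where "Z = {v. v \<noteq> 0 \<and> f v = 0 \<and> g v = 0}"
  define cls :: "'a ^ 4 \<Rightarrow> ('a ^ 4) set" where "cls v = {k *s v | k. k \<noteq> 0}" for v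
  have self: "v \<in> cls v" for v unfolding cls_def by (intro CollectI exI[of _ 1]) simp
  have cls_scale: "cls (k *s v) = cls v" if "k \<noteq> 0" for k v
  proof (intro equalityI subsetI)
    show "w \<in> cls v" if "w \<in> cls (k *s v)" for w
      using that \<open>k \<noteq> 0\<close> unfolding cls_def by (auto simp: vector_smult_assoc)
    show "w \<in> cls (k *s v)" if w: "w \<in> cls v" for w
    proof -
      obtain l where l: "l \<noteq> 0" "w = l *s v" using w unfolding cls_def by auto
      then have "w = (l / k) *s (k *s v)" using \<open>k \<noteq> 0\<close> by (simp add: vector_smult_assoc)
      then show ?thesis unfolding cls_def using l \<open>k \<noteq> 0\<close> by (intro CollectI exI[of _ "l / k"]) simp
    qed
  qed
  have X: "pg3_zero_points f \<inter> pg3_zero_points g = cls ` Z"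
  proof (intro equalityI subsetI)
    fix p assume p: "p \<in> pg3_zero_points f \<inter> pg3_zero_points g"
    then have "p \<in> pg3_points" by (simp add: pg3_zero_points_def)
    then obtain v where v: "v \<noteq> 0" "p = cls v"
      unfolding pg3_points_def cls_def by blast
    then show "p \<in> cls ` Z" using p self[of v] by (auto simp: Z_def pg3_zero_points_def)
  next
    fix p assume "p \<in> cls ` Z"
    then obtain v where v: "v \<in> Z" "p = cls v" by auto
    then have "p \<in> pg3_points" unfolding pg3_points_def cls_def Z_def by blast
    moreover have "f w = 0 \<and> g w = 0" if "w \<in> p" for w
      using that v f g by (auto simp: cls_def Z_def)
    ultimately show "p \<in> pg3_zero_points f \<inter> pg3_zero_points g"
      by (simp add: pg3_zero_points_def)
  qed
  have "card Z = (\<Sum>p\<in>cls ` Z. card {v\<in>Z. cls v = p})"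
    by (rule card_eq_sum_fibres) auto
  also have "\<dots> = (\<Sum>p\<in>cls ` Z. q\<^sup>2 - 1)"
  proof (rule sum.cong)
    fix p assume "p \<in> cls ` Z"
    then obtain v where v: "v \<in> Z" "p = cls v" by auto
    have "{w\<in>Z. cls w = p} = cls v"
    proof (intro equalityI subsetI)
      show "w \<in> cls v" if "w \<in> {w\<in>Z. cls w = p}" for w using that self[of w] v by auto
      show "w \<in> {w\<in>Z. cls w = p}" if w: "w \<in> cls v" for w
      proof -
        obtain k where k: "k \<noteq> 0" "w = k *s v" using w unfolding cls_def by auto
        then show ?thesis using v f g by (auto simp: cls_scale Z_def)
      qed
    qed
    also have "cls v = (\<lambda>k. k *s v) ` (UNIV - {0})" unfolding cls_def by auto
    also have "card \<dots> = card (UNIV - {0::'a})"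
      by (rule card_image) (use v in \<open>auto simp: inj_on_def Z_def vec_eq_iff\<close>)
    finally show "card {w\<in>Z. cls w = p} = q\<^sup>2 - 1" by (simp add: card_Diff_subset card_field)
  qed simp
  finally show ?thesis unfolding X by (simp add: Z_def mult.commute)
qed

text \<open>The slopes \<open>y / x\<close> of the lines through \<open>P\<close> in the plane
  \<open>J = 0\<close> lying on both surfaces. An infinite slope cannot occur, as
  \<open>nm x = nm y\<close> there.\<close>

definition isotropic_ratios :: "'a \<Rightarrow> 'a \<Rightarrow> 'a \<Rightarrow> 'a set" where
  "isotropic_ratios a b c = {t. nm t = 1 \<and> a + c * t + b * t\<^sup>2 = 0}"

text \<open>Three disjoint families: \<open>Z1\<close> rescales the affine points by
  \<open>J\<close>, \<open>Z2\<close> holds the multiples of \<open>P\<close>, and \<open>Z3\<close>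
  the remaining vectors of the common lines through \<open>P\<close>, where \<open>z\<close> is
  free.\<close>

lemma card_common_zeros:
  "card {(J, x, y, z). (J, x, y, z) \<noteq> 0 \<and> tr (cj J * z) + nm x + nm y = 0 \<and>
      J * z + a * x\<^sup>2 + b * y\<^sup>2 + c * x * y + d * J * x + e * J * y + f * J\<^sup>2 = 0} =
    (q\<^sup>2 - 1) * (card (affine_points a b c d e f) + 1 + q\<^sup>2 * card (isotropic_ratios a b c))"
  (is "card ?Z = _")
proof -
  define g where "g x y = a * x\<^sup>2 + b * y\<^sup>2 + c * x * y + d * x + e * y + f" for x y
  define U where "U = UNIV - {0::'a}"
  define A where "A = affine_points a b c d e f"
  define R where "R = isotropic_ratios a b c"
  define Z1 where "Z1 = (\<lambda>(J, x, y). (J, J * x, J * y, J * g x y)) ` (U \<times> A)"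
  define Z2 where "Z2 = (\<lambda>z. (0::'a, 0::'a, 0::'a, z)) ` U"
  define Z3 where "Z3 = (\<lambda>(x, t, z). (0::'a, x, t * x, z)) ` (U \<times> R \<times> (UNIV::'a set))"
  have cardU: "card U = q\<^sup>2 - 1" by (simp add: U_def card_Diff_subset card_field)
  have A_iff: "(x, y) \<in> A \<longleftrightarrow> tr (g x y) + nm x + nm y = 0" for x y
    by (simp add: A_def affine_points_def g_def add_eq_0_iff_eq add.assoc)
  have "?Z = Z1 \<union> Z2 \<union> Z3"
  proof (intro equalityI subsetI)
    fix p assume "p \<in> ?Z"
    then obtain J x y z where p: "p = (J, x, y, z)" "(J, x, y, z) \<noteq> 0"
      and H: "tr (cj J * z) + nm x + nm y = 0"
      and Q: "J * z + a * x\<^sup>2 + b * y\<^sup>2 + c * x * y + d * J * x + e * J * y + f * J\<^sup>2 = 0"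
      by auto
    show "p \<in> Z1 \<union> Z2 \<union> Z3"
    proof (cases "J = 0")
      case False
      define x' y' where "x' = x / J" and "y' = y / J"
      have xy: "x = J * x'" "y = J * y'" using False by (simp_all add: x'_def y'_def)
      have "J * (z + J * g x' y') = 0" using Q by (simp add: xy g_def algebra_simps power2_eq_square)
      then have z: "z = J * g x' y'" using False by (simp add: add_eq_0_iff_eq)
      have "tr (cj J * z) + nm x + nm y = nm J * (tr (g x' y') + nm x' + nm y')"
        by (simp add: z xy nm_def tr_def algebra_simps)
      then have "(x', y') \<in> A" using H False by (simp add: A_iff)
      then show ?thesis using False by (force simp: Z1_def p xy z U_def)
    next
      case J: True
      have nmxy: "nm x = nm y" using H J by (simp add: add_eq_0_iff_eq)
      show ?thesis
      proof (cases "x = 0")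
        case True
        then have "y = 0" using nmxy by (metis nm_eq_0_iff)
        then show ?thesis using p J True by (auto simp: Z2_def U_def zero_prod_def)
      next
        case False
        define t where "t = y / x"
        have y: "y = t * x" using False by (simp add: t_def)
        have "nm t = 1" using nmxy[symmetric] False by (simp add: t_def nm_divide)
        moreover have "x\<^sup>2 * (a + c * t + b * t\<^sup>2) = 0"
          using Q J by (simp add: y algebra_simps power2_eq_square)
        ultimately have "t \<in> R" using False by (simp add: R_def isotropic_ratios_def)
        then show ?thesis using False by (force simp: Z3_def p J y U_def)
      qed
    qed
  next
    fix p assume "p \<in> Z1 \<union> Z2 \<union> Z3"
    then consider (1) "p \<in> Z1" | (2) "p \<in> Z2" | (3) "p \<in> Z3" by blast
    then show "p \<in> ?Z"
    proof cases
      case 1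
      then obtain J x y where p: "p = (J, J * x, J * y, J * g x y)" "J \<noteq> 0" "(x, y) \<in> A"
        by (auto simp: Z1_def U_def)
      have "tr (cj J * (J * g x y)) + nm (J * x) + nm (J * y) = nm J * (tr (g x y) + nm x + nm y)"
        by (simp add: nm_def tr_def algebra_simps)
      moreover have "J * (J * g x y) + a * (J * x)\<^sup>2 + b * (J * y)\<^sup>2 + c * (J * x) * (J * y) +
          d * J * (J * x) + e * J * (J * y) + f * J\<^sup>2 = 0"
        by (simp add: g_def algebra_simps power2_eq_square)
      ultimately show ?thesis using p by (simp add: A_iff zero_prod_def)
    next
      case 2
      then show ?thesis by (auto simp: Z2_def U_def zero_prod_def nm_def)
    next
      case 3
      then obtain x t z where p: "p = (0, x, t * x, z)" "x \<noteq> 0" "t \<in> R"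
        by (auto simp: Z3_def U_def)
      have t: "nm t = 1" "a + c * t + b * t\<^sup>2 = 0" using p by (auto simp: R_def isotropic_ratios_def)
      have "a * x\<^sup>2 + b * (t * x)\<^sup>2 + c * x * (t * x) = x\<^sup>2 * (a + c * t + b * t\<^sup>2)"
        by (simp add: algebra_simps power2_eq_square)
      then show ?thesis using p t by (simp add: zero_prod_def nm_mult)
    qed
  qed
  moreover have "card (Z1 \<union> Z2 \<union> Z3) = card Z1 + card Z2 + card Z3"
  proof -
    have "Z1 \<inter> Z2 = {}" "(Z1 \<union> Z2) \<inter> Z3 = {}"
      by (auto simp: Z1_def Z2_def Z3_def U_def)
    then show ?thesis by (simp add: card_Un_disjoint)
  qed
  moreover have "card Z1 = (q\<^sup>2 - 1) * card A"
    unfolding Z1_def by (subst card_image) (auto simp: inj_on_def U_def card_cartesian_product cardU[unfolded U_def])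
  moreover have "card Z2 = q\<^sup>2 - 1"
    unfolding Z2_def by (subst card_image) (auto simp: inj_on_def cardU)
  moreover have "card Z3 = (q\<^sup>2 - 1) * (q\<^sup>2 * card R)"
    unfolding Z3_def
    by (subst card_image) (auto simp: inj_on_def U_def card_cartesian_product cardU[unfolded U_def] card_field)
  ultimately have "card ?Z = (q\<^sup>2 - 1) * card A + (q\<^sup>2 - 1) + (q\<^sup>2 - 1) * (q\<^sup>2 * card R)"
    by (simp only:)
  also have "\<dots> = (q\<^sup>2 - 1) * (card A + 1 + q\<^sup>2 * card R)"
    by (simp only: distrib_left mult_1_right)
  finally show ?thesis by (simp only: A_def R_def)
qed

section \<open>Possible sizes in terms of the coefficients\<close>

definition intersection_size :: "'a \<Rightarrow> 'a \<Rightarrow> 'a \<Rightarrow> 'a \<Rightarrow> 'a \<Rightarrow> 'a \<Rightarrow> int" where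
  "intersection_size a b c d e f =
    int (card (affine_points a b c d e f)) + 1 + (int q)\<^sup>2 * int (card (isotropic_ratios a b c))"

lemma card_isotropic_ratios_le:
  assumes "b \<noteq> 0 \<or> c \<noteq> 0"
  shows "card (isotropic_ratios a b c) \<le> 2"
proof -
  have "card (isotropic_ratios a b c) \<le> card {t. b * t\<^sup>2 + c * t + a = 0}"
    by (rule card_mono) (auto simp: isotropic_ratios_def ac_simps)
  then show ?thesis using card_quadratic_le[OF assms, of a] by simp
qed

text \<open>The elliptic case: there is no common line, and \<open>isotropic_of_radical\<close>
  excludes the subcase that could yield \<open>q\<^sup>2 + 1\<close>.\<close>

lemma intersection_size_anisotropic:
  assumes aniso: "\<And>x y. x \<noteq> 0 \<or> y \<noteq> 0 \<Longrightarrow> a * x\<^sup>2 + b * y\<^sup>2 + c * x * y \<noteq> 0"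
  defines "q' \<equiv> int q"
  shows "intersection_size a b c d e f \<in>
    {q'^3 - q'^2 + 1, q'^3 - q'^2 + q' + 1, q'^3 - q' + 1, q'^3 + 1, q'^3 + q' + 1,
     q'^3 + q'^2 - q' + 1, q'^3 + q'^2 + 1}"
proof -
  have "isotropic_ratios a b c = {}"
    using aniso[of 1] by (auto simp: isotropic_ratios_def ac_simps)
  then have I: "intersection_size a b c d e f = int (card (affine_points a b c d e f)) + 1"
    by (simp add: intersection_size_def)
  show ?thesis
  proof (cases "nm c = 1")
    case False
    from card_affine_nondegenerate[OF False, of a b d e f] show ?thesis
      unfolding I q'_def by auto
  next
    case True
    have "a \<noteq> cj b * c\<^sup>2" using isotropic_of_radical[OF True, of a b] aniso by blast
    from card_affine_parabolic[OF True this, of d e f] show ?thesis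
      unfolding I q'_def by auto
  qed
qed

text \<open>For \<open>c = 0\<close> the polar form over \<open>K\<close> is non-degenerate, and
  \<open>a + b t\<^sup>2\<close> has at most one root because squaring is injective.\<close>

lemma intersection_size_cone:
  assumes ab: "a \<noteq> 0 \<or> b \<noteq> 0"
  defines "q' \<equiv> int q"
  shows "intersection_size a b 0 d e f \<in>
    {q'^3 - q'^2 + q' + 1, q'^3 - q' + 1, q'^3 + q' + 1, q'^3 + q'^2 - q' + 1,
     q'^3 + 2*q'^2 - q' + 1}"
proof (cases "isotropic_ratios a b 0 = {}")
  case True
  from card_affine_nondegenerate[of 0 a b d e f] True show ?thesis
    unfolding intersection_size_def q'_def by (auto simp: nm_def)
next
  case False
  then obtain t where t: "t \<in> isotropic_ratios a b 0" by auto
  then have nm: "nm t = 1" and root: "a + 0 * t + b * t\<^sup>2 = 0" by (simp_all add: isotropic_ratios_def)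
  have "b \<noteq> 0" using ab root by auto
  have "s = t" if "s \<in> isotropic_ratios a b 0" for s
  proof -
    have "b * s\<^sup>2 = b * t\<^sup>2" using that root by (simp add: isotropic_ratios_def add_eq_0_iff_eq)
    then show ?thesis using \<open>b \<noteq> 0\<close> by (simp add: sq_eq_iff)
  qed
  then have "isotropic_ratios a b 0 = {t}" using t by blast
  moreover have "nm 0 \<noteq> (1::'a)" by (simp add: nm_def)
  ultimately show ?thesis
    using card_affine_isotropic_nondegenerate[OF nm root, of d e f]
    unfolding intersection_size_def q'_def by auto
qed

text \<open>For \<open>b \<noteq> 0\<close> the other root of the quadratic is
  \<open>t + c / b\<close>, and \<open>nm (b t + c) = nm b + 1 + tr (b t cj c)\<close>; so it has
  norm 1 exactly when the trace is 1.\<close>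

lemma isotropic_ratios_degenerate:
  assumes t: "t \<in> isotropic_ratios a b c" and c: "nm c = 1"
  shows "tr (b * t * cj c) \<noteq> 1 \<Longrightarrow> card (isotropic_ratios a b c) = 1"
    and "tr (b * t * cj c) = 1 \<Longrightarrow> card (isotropic_ratios a b c) = 2"
proof -
  have nm: "nm t = 1" and root: "a + c * t + b * t\<^sup>2 = 0" using t by (simp_all add: isotropic_ratios_def)
  have c0: "c \<noteq> 0" using c by (auto simp: nm_def)
  have nmb: "nm (b * t + c) = nm b + 1 + tr (b * t * cj c)"
  proof -
    have "nm (b * t + c) = nm b * nm t + nm c + tr (b * t * cj c)"
      by (simp add: nm_def tr_def algebra_simps)
    then show ?thesis by (simp add: nm c)
  qed
  show "card (isotropic_ratios a b c) = 1" if "tr (b * t * cj c) \<noteq> 1"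
  proof -
    have "s = t" if s: "s \<in> isotropic_ratios a b c" for s
    proof (rule ccontr)
      assume "s \<noteq> t"
      have nms: "nm s = 1" and "a + c * s + b * s\<^sup>2 = 0" using s by (simp_all add: isotropic_ratios_def)
      then have "(a + c * s + b * s\<^sup>2) + (a + c * t + b * t\<^sup>2) = 0" using root by simp
      then have "(s + t) * (c + b * (s + t)) = 0" by (simp add: char2)
      then have "c + b * (s + t) = 0" using \<open>s \<noteq> t\<close> by (simp add: add_eq_0_iff_eq)
      then have "(b * t + c) + b * s = 0" by (simp add: algebra_simps)
      then have "nm (b * t + c) = nm (b * s)" by (simp add: add_eq_0_iff_eq)
      then have "nm b + (1 + tr (b * t * cj c)) = nm b" by (simp add: nmb nm_mult nms add.assoc)
      then have "tr (b * t * cj c) = 1" by (simp add: add_eq_0_iff_eq)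
      then show False using \<open>tr (b * t * cj c) \<noteq> 1\<close> by blast
    qed
    then have "isotropic_ratios a b c = {t}" using t by blast
    then show ?thesis by simp
  qed
  show "card (isotropic_ratios a b c) = 2" if tr1: "tr (b * t * cj c) = 1"
  proof -
    have b0: "b \<noteq> 0" using tr1 by auto
    define s where "s = t + c / b"
    have bs: "b * s = b * t + c" using b0 by (simp add: s_def distrib_left)
    have "nm b * nm s = nm b" by (simp add: bs nmb tr1 add.assoc flip: nm_mult)
    then have "nm s = 1" using b0 by simp
    moreover have "a + c * s + b * s\<^sup>2 = 0"
    proof -
      have "a + c * s + b * s\<^sup>2 = a + s * (c + b * s)" by (simp add: algebra_simps power2_eq_square)
      also have "c + b * s = b * t" by (simp add: bs ac_simps)
      also have "a + s * (b * t) = a + b * s * t" by (simp add: ac_simps)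
      also have "\<dots> = a + (b * t + c) * t" by (simp only: bs)
      also have "\<dots> = a + c * t + b * t\<^sup>2" by (simp add: char2)
      finally show ?thesis using root by simp
    qed
    ultimately have "{s, t} \<subseteq> isotropic_ratios a b c" using t by (simp add: isotropic_ratios_def)
    moreover have "s \<noteq> t" using b0 c0 by (simp add: s_def)
    ultimately have "2 \<le> card (isotropic_ratios a b c)"
      using card_mono[of "isotropic_ratios a b c" "{s, t}"] by simp
    then show ?thesis using card_isotropic_ratios_le[of b c a] c0 by simp
  qed
qed

text \<open>The hyperbolic case. For \<open>nm c = 1\<close> the trace condition pairs each affine
  count with the right number of ratios; \<open>q\<^sup>3 + 3 q\<^sup>2 - q + 1\<close> belongs to
  two ratios with \<open>nm c \<noteq> 1\<close>.\<close>

lemma intersection_size_values: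
  assumes c0: "c \<noteq> 0"
  defines "q' \<equiv> int q"
  shows "intersection_size a b c d e f \<in>
    {q'^2 + 1, q'^3 - q'^2 + 1, q'^3 - q'^2 + q' + 1, q'^3 - q' + 1, q'^3 + 1, q'^3 + q' + 1,
     q'^3 + q'^2 - q' + 1, q'^3 + q'^2 + 1, q'^3 + 2*q'^2 - q' + 1, q'^3 + 2*q'^2 + 1,
     q'^3 + 3*q'^2 - q' + 1, 2*q'^3 + q'^2 + 1}"
proof (cases "isotropic_ratios a b c = {}")
  case empty: True
  then have I: "intersection_size a b c d e f = int (card (affine_points a b c d e f)) + 1"
    by (simp add: intersection_size_def)
  show ?thesis
  proof (cases "nm c = 1")
    case False
    from card_affine_nondegenerate[OF False, of a b d e f] show ?thesis
      unfolding I q'_def by auto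
  next
    case c: True
    show ?thesis
    proof (cases "a = cj b * c\<^sup>2")
      case False
      from card_affine_parabolic[OF c False, of d e f] show ?thesis
        unfolding I q'_def by auto
    next
      case True
      have "a + c * t + b * t\<^sup>2 \<noteq> 0" if "nm t = 1" for t
        using empty that by (auto simp: isotropic_ratios_def)
      from card_affine_anisotropic_radical[OF c True this, of d e f] show ?thesis
        unfolding I q'_def by auto
    qed
  qed
next
  case False
  then obtain t where t: "t \<in> isotropic_ratios a b c" by auto
  then have nm: "nm t = 1" and root: "a + c * t + b * t\<^sup>2 = 0" by (simp_all add: isotropic_ratios_def)
  show ?thesis
  proof (cases "nm c = 1")
    case False
    have "card (isotropic_ratios a b c) \<noteq> 0" using t by auto
    then have "card (isotropic_ratios a b c) = 1 \<or> card (isotropic_ratios a b c) = 2"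
      using card_isotropic_ratios_le[of b c a] c0 by linarith
    then show ?thesis
      using card_affine_isotropic_nondegenerate[OF nm root False, of d e f]
      unfolding intersection_size_def q'_def by auto
  next
    case c: True
    show ?thesis
    proof (cases "tr (b * t * cj c) = 1")
      case True
      show ?thesis
        using card_affine_isotropic_degenerate(2)[OF nm root c True, of d e f]
        unfolding intersection_size_def q'_def isotropic_ratios_degenerate(2)[OF t c True] by auto
    next
      case False
      show ?thesis
        using card_affine_isotropic_degenerate(1)[OF nm root c False, of d e f]
        unfolding intersection_size_def q'_def isotropic_ratios_degenerate(1)[OF t c False] by auto
    qed
  qed
qed

end

theorem theorem1:
  fixes q h :: nat
    and H A :: "'a::{field,finite} ^ 4 ^ 4"
    and P :: "'a ^ 4"
  assumes q_pow: "q = 2 ^ h"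
    and card_field: "CARD('a) = q ^ 2"
    and herm: "nondeg_hermitian q H"
    and irred: "is_elliptic_quadric (quad_form A) \<or> is_quadratic_cone (quad_form A)
                \<or> is_hyperbolic_quadric (quad_form A)"
    and P_nz: "P \<noteq> 0"
    and P_H: "herm_form q H P = 0"
    and P_Q: "quad_form A P = 0"
    and P_ns_H: "herm_nonsingular q H P"
    and P_ns_Q: "quad_nonsingular (quad_form A) P"
    and tangent: "herm_tangent_plane q H P = quad_tangent_plane (quad_form A) P"
  defines "N \<equiv> card (pg3_zero_points (herm_form q H) \<inter> pg3_zero_points (quad_form A))"
  shows "(is_elliptic_quadric (quad_form A) \<longrightarrow>
            N \<in> {q^3 - q^2 + 1, q^3 - q^2 + q + 1, q^3 - q + 1, q^3 + 1, q^3 + q + 1,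
                 q^3 + q^2 - q + 1, q^3 + q^2 + 1})
       \<and> (is_quadratic_cone (quad_form A) \<longrightarrow>
            N \<in> {q^3 - q^2 + q + 1, q^3 - q + 1, q^3 + q + 1, q^3 + q^2 - q + 1,
                 q^3 + 2*q^2 - q + 1})
       \<and> (is_hyperbolic_quadric (quad_form A) \<longrightarrow>
            N \<in> {q^2 + 1, q^3 - q^2 + 1, q^3 - q^2 + q + 1, q^3 - q + 1, q^3 + 1, q^3 + q + 1,
                 q^3 + q^2 - q + 1, q^3 + q^2 + 1, q^3 + 2*q^2 - q + 1, q^3 + 2*q^2 + 1,
                 q^3 + 3*q^2 - q + 1, 2*q^3 + q^2 + 1})"
proof -
  interpret even_square_field q h "TYPE('a)"
    by unfold_locales (fact q_pow card_field)+
  let ?B = "polar_form (quad_form A)"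
  obtain e0 e1 e2 where bij: "bij (frame e0 e1 e2 P)"
    and hP: "\<And>J x y z. herm_tangent_form q H P (frame e0 e1 e2 P (J, x, y, z)) = J"
    and hF: "\<And>J x y z. herm_form q H (frame e0 e1 e2 P (J, x, y, z)) = tr (cj J * z) + nm x + nm y"
    using hermitian_frame[OF herm P_nz P_H] by blast
  define F where "F = frame e0 e1 e2 P"
  have F_surj: "\<exists>J x y z. v = F (J, x, y, z)" for v
    using bij_is_surj[OF bij] unfolding F_def by (metis surjE prod_cases4)
  have F_0: "F 0 = 0" by (simp add: F_def frame_def zero_prod_def)
  have F_eq_0: "F p = 0 \<longleftrightarrow> p = 0" for p
    using bij_is_inj[OF bij] F_0 unfolding F_def by (metis injD)
  have F_e: "F (1, 0, 0, 0) = e0" "F (0, 1, 0, 0) = e1" "F (0, 0, 1, 0) = e2"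
    by (simp_all add: F_def frame_def)
  have tangent_iff: "herm_tangent_form q H P v = 0 \<longleftrightarrow> ?B P v = 0" for v
    using tangent by (auto simp: herm_tangent_plane_def quad_tangent_plane_def)
  \<comment> \<open>\<open>e0\<close> has \<open>J = 1\<close> and lies off the common tangent
    plane; \<open>e1\<close> and \<open>e2\<close> have \<open>J = 0\<close> and lie in it.\<close>
  have B_e: "?B P e0 \<noteq> 0" "?B P e1 = 0" "?B P e2 = 0"
    using tangent_iff hP F_e unfolding F_def by (metis zero_neq_one)+
  define l where "l = ?B P e0"
  have l: "l \<noteq> 0" using B_e by (simp add: l_def)
  define a b c d e f where abc: "a = quad_form A e1 / l" "b = quad_form A e2 / l" "c = ?B e1 e2 / l"
    "d = ?B e0 e1 / l" "e = ?B e0 e2 / l" "f = quad_form A e0 / l"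
  have qF: "quad_form A (F (J, x, y, z)) =
      l * (J * z + a * x\<^sup>2 + b * y\<^sup>2 + c * x * y + d * J * x + e * J * y + f * J\<^sup>2)" for J x y z
    unfolding F_def quad_form_frame[OF P_Q B_e(2,3)] l_def[symmetric]
    using l by (simp add: abc field_simps)
  have B_F: "?B (F (J, x, y, z)) (F (J', x', y', z')) =
      l * (J * z' + J' * z + c * (x * y' + x' * y) + d * (J * x' + J' * x) + e * (J * y' + J' * y))"
    for J x y z J' x' y' z'
  proof -
    have "F (J, x, y, z) + F (J', x', y', z') = F (J + J', x + x', y + y', z + z')"
      by (simp add: F_def frame_def vec_eq_iff algebra_simps)
    then show ?thesis by (simp add: polar_form_def qF char2)
  qed
  have N: "int N = intersection_size a b c d e f"
  proof -
    have "card {v. v \<noteq> 0 \<and> herm_form q H v = 0 \<and> quad_form A v = 0} = (q\<^sup>2 - 1) * N"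
      unfolding N_def
      by (rule card_proj_zero_points) (simp_all add: herm_form_eq hermf_linear quad_form_scale)
    moreover have "card {v. v \<noteq> 0 \<and> herm_form q H v = 0 \<and> quad_form A v = 0} =
      card {(J, x, y, z). (J, x, y, z) \<noteq> 0 \<and> tr (cj J * z) + nm x + nm y = 0 \<and>
        J * z + a * x\<^sup>2 + b * y\<^sup>2 + c * x * y + d * J * x + e * J * y + f * J\<^sup>2 = 0}" (is "card ?V = card ?W")
    proof -
      have "F ` ?W = ?V"
      proof (intro equalityI subsetI)
        fix v assume "v \<in> F ` ?W"
        then show "v \<in> ?V" using hF by (auto simp: F_eq_0 qF F_def[symmetric])
      next
        fix v assume v: "v \<in> ?V"
        obtain J x y z where Jxyz: "v = F (J, x, y, z)" using F_surj by blast
        have "(J, x, y, z) \<in> ?W"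
          using v l hF[of J x y z] unfolding F_def[symmetric] Jxyz by (simp add: F_eq_0 qF)
        then show "v \<in> F ` ?W" unfolding Jxyz by (rule imageI)
      qed
      moreover have "inj_on F ?W"
        using bij_is_inj[OF bij] unfolding F_def by (rule inj_on_subset) simp
      then have "card (F ` ?W) = card ?W" by (rule card_image)
      ultimately show ?thesis by (simp only:)
    qed
    ultimately have "(q\<^sup>2 - 1) * N =
        (q\<^sup>2 - 1) * (card (affine_points a b c d e f) + 1 + q\<^sup>2 * card (isotropic_ratios a b c))"
      by (simp only: card_common_zeros)
    moreover have "q\<^sup>2 - 1 \<noteq> 0"
      using q_ge_2 power_mono[of 2 q 2] by simp
    ultimately have "N = card (affine_points a b c d e f) + 1 + q\<^sup>2 * card (isotropic_ratios a b c)"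
      by (simp only: mult_cancel1) simp
    then show ?thesis by (simp add: intersection_size_def)
  qed
  \<comment> \<open>These bounds keep the subtractions on \<open>nat\<close> from truncating, so the
    integer lists can be carried back.\<close>
  have "q \<le> q\<^sup>2" "q\<^sup>2 \<le> q ^ 3" "q \<le> q ^ 3"
    using q_ge_2 by (simp_all add: self_le_power power_increasing)
  then have sub: "int (q ^ 3 - q\<^sup>2) = int q ^ 3 - int q ^ 2" "int (q ^ 3 - q) = int q ^ 3 - int q"
    "int (q ^ 3 + k * q\<^sup>2 - q) = int q ^ 3 + int k * int q ^ 2 - int q"
    "int (q ^ 3 + q\<^sup>2 - q) = int q ^ 3 + int q ^ 2 - int q" for k
    by (simp_all add: of_nat_diff)
  have transfer: "N \<in> S" if "int N \<in> T" "T = int ` S" for S T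
    using that by auto
  show ?thesis
  proof (intro conjI impI)
    assume ell: "is_elliptic_quadric (quad_form A)"
    have "a * x\<^sup>2 + b * y\<^sup>2 + c * x * y \<noteq> 0" if xy: "x \<noteq> 0 \<or> y \<noteq> 0" for x y
    proof
      assume zero: "a * x\<^sup>2 + b * y\<^sup>2 + c * x * y = 0"
      \<comment> \<open>A zero \<open>(x, y)\<close> of the binary form would span, together with
        \<open>P\<close>, a line on the quadric.\<close>
      have comb: "\<alpha> *s F (0, x, y, 0) + \<beta> *s P = F (0, \<alpha> * x, \<alpha> * y, \<beta>)" for \<alpha> \<beta>
        by (simp add: F_def frame_def vec_eq_iff algebra_simps)
      have "quad_form A (F (0, \<alpha> * x, \<alpha> * y, \<beta>)) = l * \<alpha>\<^sup>2 * (a * x\<^sup>2 + b * y\<^sup>2 + c * x * y)" for \<alpha> \<beta>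
        by (simp add: qF algebra_simps power2_eq_square)
      then have "quad_form A (\<alpha> *s F (0, x, y, 0) + \<beta> *s P) = 0" for \<alpha> \<beta>
        by (simp add: comb zero)
      from elliptic_no_line[OF ell this] show False
        using xy by (auto simp: comb F_eq_0 zero_prod_def)
    qed
    from intersection_size_anisotropic[OF this, of d e f]
    show "N \<in> {q^3 - q^2 + 1, q^3 - q^2 + q + 1, q^3 - q + 1, q^3 + 1, q^3 + q + 1,
                 q^3 + q^2 - q + 1, q^3 + q^2 + 1}"
      unfolding N[symmetric] by (rule transfer)
        (simp_all only: image_insert image_empty of_nat_add of_nat_mult of_nat_power of_nat_1 of_nat_numeral sub)
  next
    assume "is_quadratic_cone (quad_form A)"
    then obtain r where r: "quad_form A r \<noteq> 0" "\<And>v. ?B r v = 0"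
      by (rule cone_radical) blast
    obtain J x y z where Jxyz: "r = F (J, x, y, z)" using F_surj by blast
    \<comment> \<open>Pairing the radical vector with \<open>P\<close> gives \<open>J = 0\<close>,
      and with \<open>e2\<close>, \<open>e1\<close> gives \<open>c x = c y = 0\<close>. As the form
      is non-zero at \<open>r\<close>, one of \<open>x\<close>, \<open>y\<close> is
      non-zero.\<close>
    have J: "J = 0" using r(2)[of "F (0, 0, 0, 1)"] l unfolding Jxyz B_F by simp
    have cxy: "c * x = 0" "c * y = 0"
      using r(2)[of "F (0, 0, 1, 0)"] r(2)[of "F (0, 1, 0, 0)"] l unfolding Jxyz J B_F by simp_all
    have ne: "a * x\<^sup>2 + b * y\<^sup>2 + c * x * y \<noteq> 0" using r(1) l unfolding Jxyz J qF by simp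
    then have "c = 0" and ab: "a \<noteq> 0 \<or> b \<noteq> 0" using cxy by auto
    from intersection_size_cone[OF ab, of d e f]
    show "N \<in> {q^3 - q^2 + q + 1, q^3 - q + 1, q^3 + q + 1, q^3 + q^2 - q + 1,
                 q^3 + 2*q^2 - q + 1}"
      unfolding N[unfolded \<open>c = 0\<close>, symmetric] by (rule transfer)
        (simp only: image_insert image_empty of_nat_add of_nat_mult of_nat_power of_nat_1 of_nat_numeral sub)
  next
    assume hyp: "is_hyperbolic_quadric (quad_form A)"
    have "c \<noteq> 0"
    proof
      assume "c = 0"
      \<comment> \<open>For \<open>c = 0\<close> the vector \<open>e1 + d P\<close> would be
        radical: the pairings of \<open>e1\<close> and of \<open>d P\<close> with \<open>e0\<close>
        cancel.\<close>
      have "?B (F (0, 1, 0, d)) v = 0" for v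
      proof -
        obtain J x y z where "v = F (J, x, y, z)" using F_surj by blast
        then show ?thesis by (simp add: B_F \<open>c = 0\<close>)
      qed
      moreover have "F (0, 1, 0, d) \<noteq> 0" by (simp add: F_eq_0 zero_prod_def)
      ultimately show False using hyperbolic_polar_nondegenerate[OF hyp] by blast
    qed
    from intersection_size_values[OF this, of a b d e f]
    show "N \<in> {q^2 + 1, q^3 - q^2 + 1, q^3 - q^2 + q + 1, q^3 - q + 1, q^3 + 1, q^3 + q + 1,
                 q^3 + q^2 - q + 1, q^3 + q^2 + 1, q^3 + 2*q^2 - q + 1, q^3 + 2*q^2 + 1,
                 q^3 + 3*q^2 - q + 1, 2*q^3 + q^2 + 1}"
      unfolding N[symmetric] by (rule transfer)
        (simp only: image_insert image_empty of_nat_add of_nat_mult of_nat_power of_nat_1 of_nat_numeral sub)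
  qed
qed

end
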